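(* Let $D\ge 1$ be an integer and let $\mathcal R=\{\nu\in\mathcal M_1:\|\nu\|\ge 0\}=\{\nu\in\mathcal M_1:\|\nu\|>-\infty\}$ be the set of Borel probability measures on $[0,1]$ with finite grid entropy. Then almost surely $$\mathcal R=\{\text{limit points of }\tfrac1n\mu_{0\to n}(\chi):\chi\text{ a strategy}\}=\{\text{limit points of }\tfrac1n\mu_{0\to n}(\chi):\chi\text{ an independent strategy}\}=\{\sigma_{\vec p}:\vec p\text{ a single-edge strategy}\}.$$
   Context: $\Lambda$ is Lebesgue measure on $[0,1]$; $\mathcal M_1$ is the space of Borel probability measures on $[0,1]$ with the weak topology, and limit points are weak limit points. Strategies. A strategy is a probability measure $\chi$ on $([0,1]^D)^{\mathbb Z_{\ge0}}\times\{1,\dots,D\}^{\mathbb Z_{\ge0}}$ such that under $\chi$ the first coordinate (the environment) $(U_i^j)_{i\ge0,1\le j\le D}$ is an i.i.d. array of Unif$[0,1]$ variables. The second coordinate is denoted $(J_i)_{i\ge0}$. Put $X_i(\chi)=U_i^{J_i}$ and $\frac1n\mu_{0\to n}(\chi)=\frac1n\sum_{i=0}^{n-1}\delta_{X_i(\chi)}\in\mathcal M_1$. Single-edge strategies. A single-edge strategy is a probability measure $\psi$ on $[0,1]^D\times\{1,\dots,D\}$ whose first marginal is $\Lambda^{\times D}$; with $((U^j)_{1\le j\le D},J)$ denoting the coordinates, $\sigma_\psi$ is the law of $X(\psi)=U^J$. Equivalently it is given by a vector $\vec p=(p_1,\dots,p_D)$ of measurable functions $p_k:[0,1]^D\to[0,1]$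 with $\sum_kp_k\equiv1$, where $p_k(u_1,\dots,u_D)=P_\psi[J=k\mid U^1=u_1,\dots,U^D=u_D]$; write $\sigma_{\vec p}=\sigma_\psi$. An independent strategy is a strategy of the form $\chi=\prod_{i=0}^\infty\psi_i$ (infinite product measure, the $i$-th factor governing $((U_i^j)_j,J_i)$) with each $\psi_i$ a single-edge strategy. Grid entropy. Let $(U_i^j)_{i\ge0,1\le j\le D}$ be i.i.d. Unif$[0,1]$. A path $\pi:0\to n$ is a sequence $(j_0,\dots,j_{n-1})\in\{1,\dots,D\}^n$, with $\frac1n\mu_\pi=\frac1n\sum_{i=0}^{n-1}\delta_{U_i^{j_i}}$. Let $\rho$ be the Levy-Prokhorov metric: $\rho(\mu,\nu)=\inf\{\epsilon>0:\mu(A)\le\nu(A^\epsilon)+\epsilon\text{ and }\nu(A)\le\mu(A^\epsilon)+\epsilon\ \forall A\text{ Borel}\}$, $A^\epsilon$ being the $\epsilon$-neighbourhood of $A$. For $\nu\in\mathcal M_1$ let $\min^k_{\pi:0\to n}\rho(\frac1n\mu_\pi,\nu)$ be the $k$-th smallest of the $D^n$ values $\rho(\frac1n\mu_\pi,\nu)$ (counted with multiplicity), and $+\infty$ if $k>D^n$. The grid entropy of $\nu$ is $$\|\nu\|=\sup\Big\{\alpha\ge0:\lim_{n\to\infty}\min^{\lfloor e^{\alpha n}\rfloor}_{\pi:0\to n}\rho\big(\tfrac1n\mu_\pi,\nu\big)=0\text{ a.s.}\Big\}\in\{-\infty\}\cup[0,\log D],$$ with value $-\infty$ if the set of $\alpha$'s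 is empty. *)

theory Defs
  imports "HOL-Probability.Probability"
begin

section \<open>Probability measures on the unit interval\<close>

definition unif :: "real measure" where
  "unif = restrict_space lborel {0..1}"

definition M1 :: "real measure set" where
  "M1 = {\<nu>. prob_space \<nu> \<and> sets \<nu> = sets unif}"

definition weakly_converges :: "(nat \<Rightarrow> real measure) \<Rightarrow> real measure \<Rightarrow> bool" where
  "weakly_converges \<mu> \<nu> \<longleftrightarrow>
     (\<forall>f::real \<Rightarrow> real. continuous_on {0..1} f \<longrightarrow>
        (\<lambda>n. \<integral>x. f x \<partial>(\<mu> n)) \<longlonglongrightarrow> (\<integral>x. f x \<partial>\<nu>))"

text \<open>The weak topology on \<^const>\<open>M1\<close> is metrizable, so the limit points of a sequence
  are its subsequential limits.\<close>

definition limit_points :: "(nat \<Rightarrow> real measure) \<Rightarrow> real measure set" where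
  "limit_points \<mu> = {\<nu> \<in> M1. \<exists>r. strict_mono r \<and> weakly_converges (\<mu> \<circ> r) \<nu>}"

text \<open>The neighbourhood is taken inside the metric space \<open>[0,1]\<close>.\<close>

definition nbhd :: "real \<Rightarrow> real set \<Rightarrow> real set" where
  "nbhd \<epsilon> A = {x \<in> {0..1}. \<exists>a\<in>A. dist x a < \<epsilon>}"

definition levy_prokhorov :: "real measure \<Rightarrow> real measure \<Rightarrow> real" where
  "levy_prokhorov \<mu> \<nu> = Inf {\<epsilon>. \<epsilon> > 0 \<and>
     (\<forall>A\<in>sets unif. measure \<mu> A \<le> measure \<nu> (nbhd \<epsilon> A) + \<epsilon> \<and>
                    measure \<nu> A \<le> measure \<mu> (nbhd \<epsilon> A) + \<epsilon>)}"

text \<open>The empirical measure \<open>(1/n) \<Sum>i<n. \<delta>(x i)\<close>; it belongs to \<^const>\<open>M1\<close> if \<open>n > 0\<close>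
  and is the null measure if \<open>n = 0\<close>.\<close>

definition empirical :: "(nat \<Rightarrow> real) \<Rightarrow> nat \<Rightarrow> real measure" where
  "empirical x n = measure_of {0..1} (sets unif)
     (\<lambda>A. (\<Sum>i<n. emeasure (return unif (x i)) A) / of_nat n)"


section \<open>Environments and strategies\<close>

definition cube :: "nat \<Rightarrow> (nat \<Rightarrow> real) measure" where
  "cube D = PiM {1..D} (\<lambda>_. unif)"

definition environment :: "nat \<Rightarrow> (nat \<Rightarrow> nat \<Rightarrow> real) measure" where
  "environment D = PiM UNIV (\<lambda>_. cube D)"

text \<open>In \<open>(u, j)\<close>, the number \<open>u i k\<close> is the label \<open>U\<^sub>i\<^sup>k\<close> and \<open>j i\<close> is the
  choice \<open>J\<^sub>i\<close>. Only the measurable structure of this space is used.\<close>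

definition strategy_space :: "nat \<Rightarrow> ((nat \<Rightarrow> nat \<Rightarrow> real) \<times> (nat \<Rightarrow> nat)) measure" where
  "strategy_space D = environment D \<Otimes>\<^sub>M PiM UNIV (\<lambda>_. count_space {1..D})"

definition strategy :: "nat \<Rightarrow> ((nat \<Rightarrow> nat \<Rightarrow> real) \<times> (nat \<Rightarrow> nat)) measure \<Rightarrow> bool" where
  "strategy D S \<longleftrightarrow>
     prob_space S \<and> sets S = sets (strategy_space D) \<and>
     distr S (environment D) fst = environment D"

definition observed :: "(nat \<Rightarrow> nat \<Rightarrow> real) \<times> (nat \<Rightarrow> nat) \<Rightarrow> nat \<Rightarrow> real" where
  "observed \<omega> i = fst \<omega> i (snd \<omega> i)"

definition single_edge_strategy :: "nat \<Rightarrow> ((nat \<Rightarrow> real) \<times> nat) measure \<Rightarrow> bool" where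
  "single_edge_strategy D \<psi> \<longleftrightarrow>
     prob_space \<psi> \<and> sets \<psi> = sets (cube D \<Otimes>\<^sub>M count_space {1..D}) \<and>
     distr \<psi> (cube D) fst = cube D"

definition single_edge_law :: "((nat \<Rightarrow> real) \<times> nat) measure \<Rightarrow> real measure" where
  "single_edge_law \<psi> = distr \<psi> unif (\<lambda>(u, j). u j)"

definition choice_vector :: "nat \<Rightarrow> (nat \<Rightarrow> (nat \<Rightarrow> real) \<Rightarrow> real) \<Rightarrow> bool" where
  "choice_vector D p \<longleftrightarrow>
     (\<forall>k\<in>{1..D}. p k \<in> borel_measurable (cube D) \<and> (\<forall>u\<in>space (cube D). 0 \<le> p k u \<and> p k u \<le> 1)) \<and>
     (\<forall>u\<in>space (cube D). (\<Sum>k\<in>{1..D}. p k u) = 1)"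

text \<open>The single-edge strategy with conditional probabilities \<open>P[J = k | U = u] = p k u\<close>:
  its density with respect to (uniform on the cube) times (counting measure) is \<open>p k u\<close>.\<close>

definition single_edge_of :: "nat \<Rightarrow> (nat \<Rightarrow> (nat \<Rightarrow> real) \<Rightarrow> real) \<Rightarrow> ((nat \<Rightarrow> real) \<times> nat) measure" where
  "single_edge_of D p = density (cube D \<Otimes>\<^sub>M count_space {1..D}) (\<lambda>(u, k). ennreal (p k u))"

definition sigma_law :: "nat \<Rightarrow> (nat \<Rightarrow> (nat \<Rightarrow> real) \<Rightarrow> real) \<Rightarrow> real measure" where
  "sigma_law D p = single_edge_law (single_edge_of D p)"

text \<open>The infinite product of the \<open>\<psi> i\<close>, with the coordinates regrouped from a sequence of
  pairs to a pair of sequences.\<close>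

definition product_strategy ::
    "nat \<Rightarrow> (nat \<Rightarrow> ((nat \<Rightarrow> real) \<times> nat) measure) \<Rightarrow> ((nat \<Rightarrow> nat \<Rightarrow> real) \<times> (nat \<Rightarrow> nat)) measure" where
  "product_strategy D \<psi> =
     distr (PiM UNIV \<psi>) (strategy_space D) (\<lambda>w. (\<lambda>i. fst (w i), \<lambda>i. snd (w i)))"

definition independent_strategy :: "nat \<Rightarrow> ((nat \<Rightarrow> nat \<Rightarrow> real) \<times> (nat \<Rightarrow> nat)) measure \<Rightarrow> bool" where
  "independent_strategy D S \<longleftrightarrow>
     (\<exists>\<psi>. (\<forall>i. single_edge_strategy D (\<psi> i)) \<and> S = product_strategy D \<psi>)"

text \<open>All strategies played on one probability space, in one common environment \<open>U\<close>. This makes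
  the set of limit points over all strategies a random set, about which one can speak almost
  surely. Such couplings exist: take \<open>J S\<close> to be a measurable function of the environment and
  of an independent uniform variable, by disintegrating \<open>S\<close> over the environment.\<close>

definition common_environment ::
    "nat \<Rightarrow> 'w measure \<Rightarrow> ('w \<Rightarrow> nat \<Rightarrow> nat \<Rightarrow> real) \<Rightarrow>
     (((nat \<Rightarrow> nat \<Rightarrow> real) \<times> (nat \<Rightarrow> nat)) measure \<Rightarrow> 'w \<Rightarrow> nat \<Rightarrow> nat) \<Rightarrow> bool" where
  "common_environment D M U J \<longleftrightarrow>
     prob_space M \<and>
     (\<forall>S. strategy D S \<longrightarrow>
        (\<lambda>w. (U w, J S w)) \<in> measurable M (strategy_space D) \<and>
        distr M (strategy_space D) (\<lambda>w. (U w, J S w)) = S)"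


section \<open>Grid entropy\<close>

definition paths :: "nat \<Rightarrow> nat \<Rightarrow> (nat \<Rightarrow> nat) set" where
  "paths D n = {..<n} \<rightarrow>\<^sub>E {1..D}"

text \<open>The \<open>k\<close>-th smallest value for \<open>k \<ge> 1\<close>, counted with multiplicity.\<close>

definition kth_min :: "nat \<Rightarrow> 'b set \<Rightarrow> ('b \<Rightarrow> real) \<Rightarrow> ereal" where
  "kth_min k S f =
     (if k \<le> card S then ereal (sorted_list_of_multiset (image_mset f (mset_set S)) ! (k - 1)) else \<infinity>)"

text \<open>The supremum is taken in the extended reals, where \<open>Sup {} = -\<infinity>\<close>.\<close>

definition grid_entropy :: "nat \<Rightarrow> real measure \<Rightarrow> ereal" where
  "grid_entropy D \<nu> = Sup (ereal ` {\<alpha>. 0 \<le> \<alpha> \<and>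
     (AE u in environment D.
        (\<lambda>n. kth_min (nat \<lfloor>exp (\<alpha> * real n)\<rfloor>) (paths D n)
               (\<lambda>\<pi>. levy_prokhorov (empirical (observed (u, \<pi>)) n) \<nu>)) \<longlonglongrightarrow> 0)})"

definition finite_entropy :: "nat \<Rightarrow> real measure set" where
  "finite_entropy D = {\<nu> \<in> M1. grid_entropy D \<nu> \<ge> 0}"

lemma finite_entropy_alt: "finite_entropy D = {\<nu> \<in> M1. grid_entropy D \<nu> > -\<infinity>}"
proof -
  have "0 \<le> grid_entropy D \<nu> \<longleftrightarrow> -\<infinity> < grid_entropy D \<nu>" for \<nu>
  proof
    assume "-\<infinity> < grid_entropy D \<nu>"
    then show "0 \<le> grid_entropy D \<nu>"
      unfolding grid_entropy_def by (auto simp: less_Sup_iff intro: Sup_upper2)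
  next
    assume "0 \<le> grid_entropy D \<nu>"
    then show "-\<infinity> < grid_entropy D \<nu>"
      by (metis MInfty_neq_ereal(1) ereal_infty_less(2) ereal_infty_less_eq(2) zero_ereal_def)
  qed
  then show ?thesis
    by (simp add: finite_entropy_def)
qed


section \<open>Basic properties\<close>

lemma space_unif [simp]: "space unif = {0..1}"
  by (simp add: unif_def space_restrict_space)

lemma prob_space_unif: "prob_space unif"
  by (rule prob_spaceI) (simp add: unif_def emeasure_restrict_space space_restrict_space)

lemma space_empirical [simp]: "space (empirical x n) = {0..1}"
  unfolding empirical_def using sets.space_closed[of unif] by (simp add: space_measure_of)

lemma sets_empirical [simp]: "sets (empirical x n) = sets unif"
  unfolding empirical_def using sets.sigma_sets_eq[of unif] sets.space_closed[of unif] by simp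

lemma emeasure_empirical:
  assumes "A \<in> sets unif"
  shows "emeasure (empirical x n) A = (\<Sum>i<n. indicator A (x i)) / of_nat n"
proof -
  have "emeasure (empirical x n) A = (\<Sum>i<n. emeasure (return unif (x i)) A) / of_nat n"
  proof (rule emeasure_measure_of[OF empirical_def])
    show "countably_additive (sets (empirical x n))
        (\<lambda>A. (\<Sum>i<n. emeasure (return unif (x i)) A) / of_nat n)"
    proof (rule countably_additiveI)
      fix F :: "nat \<Rightarrow> real set"
      assume F: "range F \<subseteq> sets (empirical x n)" "disjoint_family F"
      have "(\<Sum>j. \<Sum>i<n. emeasure (return unif (x i)) (F j))
          = (\<Sum>i<n. \<Sum>j. emeasure (return unif (x i)) (F j))"
        by (rule suminf_sum) simp
      also have "\<dots> = (\<Sum>i<n. emeasure (return unif (x i)) (\<Union>j. F j))"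
        using F by (intro sum.cong refl suminf_emeasure) auto
      finally show "(\<Sum>j. (\<Sum>i<n. emeasure (return unif (x i)) (F j)) / of_nat n)
          = (\<Sum>i<n. emeasure (return unif (x i)) (\<Union>j. F j)) / of_nat n"
        by (simp add: divide_ennreal_def)
    qed
  qed (use assms sets.space_closed[of unif] in \<open>auto simp: positive_def\<close>)
  then show ?thesis
    using assms by simp
qed

lemma empirical_in_M1:
  assumes "n > 0" "\<And>i. i < n \<Longrightarrow> x i \<in> {0..1}"
  shows "empirical x n \<in> M1"
proof -
  have "emeasure (empirical x n) (space (empirical x n)) = (\<Sum>i<n. indicator {0..1} (x i)) / of_nat n"
    using emeasure_empirical[of "{0..1}"] sets.top[of unif] by simp
  also have "(\<Sum>i<n. indicator {0..1} (x i) :: ennreal) = of_nat n"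
    using assms(2) by (simp add: indicator_def)
  finally show ?thesis
    using assms(1) by (auto simp: M1_def of_nat_less_top intro!: prob_spaceI ennreal_divide_self)
qed

lemma prob_space_cube: "prob_space (cube D)"
  unfolding cube_def by (intro prob_space_PiM prob_space_unif)

lemma prob_space_environment: "prob_space (environment D)"
  unfolding environment_def by (intro prob_space_PiM prob_space_cube)

lemma measurable_choice_vector:
  assumes "choice_vector D p"
  shows "(\<lambda>(u, k). ennreal (p k u)) \<in> borel_measurable (cube D \<Otimes>\<^sub>M count_space {1..D})"
proof -
  have "(\<lambda>z. ennreal (p (snd z) (fst z))) \<in> borel_measurable (cube D \<Otimes>\<^sub>M count_space {1..D})"
  proof (rule measurable_compose_countable'[where I = "{1..D}"])
    show "(\<lambda>z. ennreal (p k (fst z))) \<in> borel_measurable (cube D \<Otimes>\<^sub>M count_space {1..D})"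
      if "k \<in> {1..D}" for k
      using assms that unfolding choice_vector_def
      by (intro measurable_compose[OF _ measurable_ennreal] measurable_compose[OF measurable_fst]) blast
  qed simp_all
  then show ?thesis
    by (simp add: case_prod_beta')
qed

lemma single_edge_strategy_of:
  assumes "choice_vector D p"
  shows "single_edge_strategy D (single_edge_of D p)"
proof -
  let ?C = "count_space {1..D}"
  interpret C: sigma_finite_measure ?C
    by (rule sigma_finite_measure_count_space_finite) simp
  have sets: "sets (single_edge_of D p) = sets (cube D \<Otimes>\<^sub>M ?C)"
    unfolding single_edge_of_def by (rule sets_density)
  have marg: "distr (single_edge_of D p) (cube D) fst = cube D"
  proof (rule measure_eqI)
    fix A assume "A \<in> sets (distr (single_edge_of D p) (cube D) fst)"
    then have A [measurable]: "A \<in> sets (cube D)" by simp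
    have AD: "A \<times> {1..D} \<in> sets (cube D \<Otimes>\<^sub>M ?C)"
      using A by (intro pair_measureI) auto
    have meas: "(\<lambda>z. (case z of (u, k) \<Rightarrow> ennreal (p k u)) * indicator (A \<times> {1..D}) z)
        \<in> borel_measurable (cube D \<Otimes>\<^sub>M ?C)"
      by (intro borel_measurable_times_ennreal measurable_choice_vector[OF assms]
            borel_measurable_indicator AD)
    have "emeasure (distr (single_edge_of D p) (cube D) fst) A
        = emeasure (single_edge_of D p) (A \<times> {1..D})"
      using sets.sets_into_space[OF A]
      by (subst emeasure_distr)
         (auto simp: single_edge_of_def space_pair_measure intro!: arg_cong2[where f=emeasure])
    also have "\<dots> = (\<integral>\<^sup>+z. (case z of (u, k) \<Rightarrow> ennreal (p k u)) * indicator (A \<times> {1..D}) z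
                      \<partial>(cube D \<Otimes>\<^sub>M ?C))"
      unfolding single_edge_of_def by (rule emeasure_density) (rule measurable_choice_vector[OF assms], rule AD)
    also have "\<dots> = (\<integral>\<^sup>+u. \<integral>\<^sup>+k. ennreal (p k u) * indicator (A \<times> {1..D}) (u, k) \<partial>?C \<partial>cube D)"
      by (subst C.nn_integral_fst[OF meas, symmetric]) simp
    also have "\<dots> = (\<integral>\<^sup>+u. indicator A u \<partial>cube D)"
    proof (rule nn_integral_cong)
      fix u assume u: "u \<in> space (cube D)"
      have "(\<integral>\<^sup>+k. ennreal (p k u) * indicator (A \<times> {1..D}) (u, k) \<partial>?C)
          = (\<Sum>k\<in>{1..D}. ennreal (p k u)) * indicator A u"
        by (simp add: nn_integral_count_space_finite indicator_times sum_distrib_right)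
      also have "(\<Sum>k\<in>{1..D}. ennreal (p k u)) = ennreal (\<Sum>k\<in>{1..D}. p k u)"
        using assms u by (intro sum_ennreal) (auto simp: choice_vector_def)
      finally show "(\<integral>\<^sup>+k. ennreal (p k u) * indicator (A \<times> {1..D}) (u, k) \<partial>?C) = indicator A u"
        using assms u by (simp add: choice_vector_def)
    qed
    finally show "emeasure (distr (single_edge_of D p) (cube D) fst) A = emeasure (cube D) A"
      by simp
  qed simp
  have "fst \<in> measurable (single_edge_of D p) (cube D)"
    unfolding measurable_cong_sets[OF sets refl] by measurable
  then have "prob_space (single_edge_of D p)"
    using marg prob_space_cube[of D] prob_space_distrD by metis
  then show ?thesis
    by (simp add: single_edge_strategy_def sets marg)
qed

lemma strategy_independent:
  assumes "independent_strategy D S"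
  shows "strategy D S"
proof -
  obtain \<psi> where \<psi>: "\<And>i. single_edge_strategy D (\<psi> i)" and S: "S = product_strategy D \<psi>"
    using assms by (auto simp: independent_strategy_def)
  let ?h = "\<lambda>w. (\<lambda>i. fst (w i), \<lambda>i. snd (w i))"
  have sets: "sets (\<psi> i) = sets (cube D \<Otimes>\<^sub>M count_space {1..D})" for i
    using \<psi> by (simp add: single_edge_strategy_def)
  have prob: "prob_space (\<psi> i)" for i
    using \<psi> by (simp add: single_edge_strategy_def)
  have fst: "fst \<in> measurable (\<psi> i) (cube D)" for i
    unfolding measurable_cong_sets[OF sets refl] by measurable
  have snd: "snd \<in> measurable (\<psi> i) (count_space {1..D})" for i
    unfolding measurable_cong_sets[OF sets refl] by measurable
  have fst_i: "(\<lambda>w. fst (w i)) \<in> measurable (PiM UNIV \<psi>) (cube D)" for i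
    using measurable_component_singleton[of i UNIV \<psi>] fst by (rule measurable_compose) simp
  have snd_i: "(\<lambda>w. snd (w i)) \<in> measurable (PiM UNIV \<psi>) (count_space {1..D})" for i
    using measurable_component_singleton[of i UNIV \<psi>] snd by (rule measurable_compose) simp
  let ?f = "\<lambda>w i. fst (w i)"
  have f: "?f \<in> measurable (PiM UNIV \<psi>) (environment D)"
    unfolding environment_def using measurable_space[OF fst_i]
    by (intro measurable_PiM_single' fst_i) auto
  have g: "(\<lambda>w i. snd (w i)) \<in> measurable (PiM UNIV \<psi>) (PiM UNIV (\<lambda>_. count_space {1..D}))"
    using measurable_space[OF snd_i] by (intro measurable_PiM_single' snd_i) auto
  have h: "?h \<in> measurable (PiM UNIV \<psi>) (strategy_space D)"
    unfolding strategy_space_def using f g by (rule measurable_Pair)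
  have "distr S (environment D) fst = distr (PiM UNIV \<psi>) (environment D) ?f"
    unfolding S product_strategy_def
    by (subst distr_distr[OF _ h]) (simp_all add: strategy_space_def comp_def)
  also have "\<dots> = environment D"
  proof -
    interpret E: product_prob_space "\<lambda>_. cube D" UNIV
      using prob_space_cube by (intro product_prob_spaceI)
    show ?thesis
      unfolding environment_def
    proof (rule E.PiM_eq)
      fix I :: "nat set" and F
      assume I: "finite I" and F: "\<And>i. i \<in> I \<Longrightarrow> F i \<in> sets (cube D)"
      let ?E = "prod_emb UNIV (\<lambda>_. cube D) I (Pi\<^sub>E I F)"
      let ?G = "\<lambda>i. fst -` F i \<inter> space (\<psi> i)"
      have G: "?G i \<in> sets (\<psi> i)" if "i \<in> I" for i
        using F[OF that] fst by (rule measurable_sets[rotated])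
      have E: "?E \<in> sets (PiM UNIV (\<lambda>_. cube D))"
        using I F by (intro sets_PiM_I) auto
      have "emeasure (distr (PiM UNIV \<psi>) (PiM UNIV (\<lambda>_. cube D)) ?f) ?E
          = emeasure (PiM UNIV \<psi>) (?f -` ?E \<inter> space (PiM UNIV \<psi>))"
        using f E unfolding environment_def by (rule emeasure_distr)
      also have "?f -` ?E \<inter> space (PiM UNIV \<psi>) = prod_emb UNIV \<psi> I (Pi\<^sub>E I ?G)"
        by (auto simp: prod_emb_def space_PiM PiE_iff intro: measurable_space[OF fst])
      also have "emeasure (PiM UNIV \<psi>) \<dots> = (\<Prod>i\<in>I. emeasure (\<psi> i) (?G i))"
        using I G by (intro emeasure_PiM_emb prob) auto
      also have "\<dots> = (\<Prod>i\<in>I. emeasure (distr (\<psi> i) (cube D) fst) (F i))"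
        using fst F by (intro prod.cong refl emeasure_distr[symmetric]) auto
      also have "\<dots> = (\<Prod>i\<in>I. emeasure (cube D) (F i))"
        using \<psi> by (simp add: single_edge_strategy_def)
      finally show "emeasure (distr (PiM UNIV \<psi>) (PiM UNIV (\<lambda>_. cube D)) ?f) ?E
          = (\<Prod>i\<in>I. emeasure (cube D) (F i))" .
    qed simp
  qed
  finally have "distr S (environment D) fst = environment D" .
  moreover have "prob_space S"
    unfolding S product_strategy_def by (intro prob_space.prob_space_distr prob_space_PiM prob h)
  ultimately show ?thesis
    by (simp add: strategy_def S product_strategy_def)
qed

end

theory Submission
  imports Defs "HOL-Complex_Analysis.Great_Picard"
begin

text \<open>Let \<open>\<Sigma>\<close> be the set of the laws \<open>\<sigma>\<^sub>p\<close>. Almost surely, every limit of empirical measures along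
  arbitrary paths, the paths being allowed to change with \<open>n\<close>, lies in \<open>\<Sigma>\<close>: on a countable algebra
  generating the Borel sets of the cube, the joint frequencies of \<open>U\<^sub>i \<in> A\<close>, \<open>J\<^sub>i = k\<close> converge along
  a subsequence; the limits are contents in \<open>A\<close> whose sum over \<open>k\<close> is the uniform measure (by the law
  of large numbers), hence they are dominated by it, extend to measures, and have densities \<open>p\<^sub>k\<close>
  with sum 1. This gives the upper bound for the limit points of all strategies simultaneously, and
  also for the measures of finite entropy.

  Conversely the law of large numbers for the strategy that repeats one single-edge strategy shows
  that \<open>\<sigma>\<^sub>p\<close> has finite entropy. Finally, an independent strategy that plays single-edge strategies with
  laws from a countable dense subset of \<open>\<Sigma>\<close>, each of them infinitely often, in blocks that are much
  longer than their past, has almost surely all of \<open>\<Sigma>\<close> as limit points; this one strategy is what makes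
  the equalities hold outside a single null set.\<close>

section \<open>Strong law of large numbers\<close>

text \<open>The obstacle is the size of the families involved: a union bound over paths would cost a
  factor D^n, and uncountably many strategies cannot each have a null set of their own. Hence the
  upper bound treats the choices as arbitrary deterministic sequences and spends probability only on
  the frequencies of countably many events about the environment; the same null set then serves
  every path and every strategy. The frequencies record the whole vector of labels together with the
  choice, not just the observed label, because p has to be recovered as a function of that vector.
  Weak convergence and convergence in the Levy-Prokhorov metric are never compared with each other.
  Each is reached from distribution functions at rational points, and each implies a two-sided
  comparison of distribution functions at neighbouring points, which is enough to identify the
  limit.\<close>

lemma (in prob_space) strong_law_bounded:
  fixes X :: "nat \<Rightarrow> 'a \<Rightarrow> real"
  assumes indep: "indep_vars (\<lambda>_. borel) X UNIV"
    and bounded: "\<And>i. AE w in M. X i w \<in> {0..1}"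
  shows "AE w in M. (\<lambda>n. ((\<Sum>i<n. X i w) - (\<Sum>i<n. expectation (X i))) / real n) \<longlonglongrightarrow> 0"
proof -
  have rv [measurable]: "random_variable borel (X i)" for i
    using indep unfolding indep_vars_def by auto
  define d where "d n w = \<bar>(\<Sum>i<n. X i w) - (\<Sum>i<n. expectation (X i))\<bar>" for n w
  have d [measurable]: "random_variable borel (d n)" for n
    unfolding d_def by measurable
  have dev: "AE w in M. eventually (\<lambda>n. d n w / real n < \<epsilon>) sequentially" if \<epsilon>: "\<epsilon> > 0" for \<epsilon> :: real
  proof -
    define A where "A n = {w\<in>space M. d n w \<ge> \<epsilon> * real n}" for n
    have A [measurable]: "A n \<in> events" for n
      unfolding A_def by measurable
    \<comment> \<open>Hoeffding's inequality for ranges of length 1 and deviation \<epsilon> n gives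
      a geometric bound, so the first Borel-Cantelli lemma applies directly. At n = 0 the bound is 2
      and holds trivially.\<close>
    have le: "prob (A n) \<le> 2 * exp (-2 * \<epsilon>\<^sup>2) ^ n" for n
    proof (cases "n = 0")
      case False
      interpret Hoeffding_ineq M "{..<n}" X "\<lambda>_. 0" "\<lambda>_. 1" "\<Sum>i<n. expectation (X i)"
        using indep_vars_subset[OF indep] bounded by unfold_locales auto
      have "prob (A n) \<le> 2 * exp (-2 * (\<epsilon> * real n)\<^sup>2 / (\<Sum>i<n. (1 - 0)\<^sup>2))"
        unfolding A_def d_def using \<epsilon> False by (intro Hoeffding_ineq_abs_ge) auto
      also have "-2 * (\<epsilon> * real n)\<^sup>2 / (\<Sum>i<n. (1 - 0)\<^sup>2) = real n * (-2 * \<epsilon>\<^sup>2)"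
        using False by (simp add: power2_eq_square)
      finally show ?thesis
        by (simp only: exp_of_nat_mult)
    qed (simp add: order.trans[OF prob_le_1])
    have "summable (\<lambda>n. 2 * exp (-2 * \<epsilon>\<^sup>2) ^ n)"
      using \<epsilon> by (intro summable_mult summable_geometric) simp
    then have "summable (\<lambda>n. prob (A n))"
      by (rule summable_comparison_test'[where N=0]) (use le in simp)
    then have "AE w in M. eventually (\<lambda>n. w \<in> space M - A n) sequentially"
      by (intro borel_cantelli_AE1) (auto simp: emeasure_eq_measure)
    then show ?thesis
    proof eventually_elim
      case (elim w)
      show ?case
        using elim eventually_gt_at_top[of 0]
        by eventually_elim (auto simp: A_def field_simps)
    qed
  qed
  \<comment> \<open>Countably many tolerances 1 / (k + 1), so that their null sets still add up to a
    null set.\<close>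
  have "AE w in M. \<forall>k. eventually (\<lambda>n. d n w / real n < 1 / real (Suc k)) sequentially"
    unfolding AE_all_countable by (intro allI dev) simp
  then show ?thesis
  proof eventually_elim
    case (elim w)
    show ?case
    proof (rule LIMSEQ_I)
      fix r :: real assume "r > 0"
      then obtain k where k: "1 / real (Suc k) < r"
        using nat_approx_posE by blast
      obtain N where N: "\<And>n. n \<ge> N \<Longrightarrow> d n w / real n < 1 / real (Suc k)"
        using elim[rule_format, of k] unfolding eventually_sequentially by blast
      show "\<exists>no. \<forall>n\<ge>no. norm (((\<Sum>i<n. X i w) - (\<Sum>i<n. expectation (X i))) / real n - 0) < r"
        using N k unfolding d_def by (intro exI[of _ N]) (fastforce simp: abs_divide)
    qed
  qed
qed

text \<open>The factors may differ, since the strategy built near the end changes its single-edge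
  strategy from block to block. Hence the frequencies are compared with the averaged probabilities
  instead of one limit.\<close>

lemma strong_law_PiM:
  fixes N :: "nat \<Rightarrow> 'a measure"
  assumes prob: "\<And>i. prob_space (N i)" and E: "\<And>i. E i \<in> sets (N i)"
  shows "AE w in PiM UNIV N.
    (\<lambda>n. ((\<Sum>i<n. indicat_real (E i) (w i)) - (\<Sum>i<n. measure (N i) (E i))) / real n) \<longlonglongrightarrow> 0"
proof -
  interpret P: product_prob_space N UNIV
    using prob by (intro product_prob_spaceI)
  have rv: "(\<lambda>w. w i) \<in> measurable (PiM UNIV N) (N i)" for i
    by measurable
  have ind: "P.indep_vars N (\<lambda>i w. w i) UNIV"
    using rv by (subst P.indep_vars_iff_distr_eq_PiM)
       (simp_all add: distr_PiM_component prob restrict_UNIV distr_id cong: PiM_cong)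
  have "P.indep_vars (\<lambda>_. borel) (\<lambda>i. indicat_real (E i) \<circ> (\<lambda>w. w i)) UNIV"
    using E by (intro P.indep_vars_compose[OF ind]) auto
  then have "AE w in PiM UNIV N.
    (\<lambda>n. ((\<Sum>i<n. (indicat_real (E i) \<circ> (\<lambda>w. w i)) w)
        - (\<Sum>i<n. P.expectation (indicat_real (E i) \<circ> (\<lambda>w. w i)))) / real n) \<longlonglongrightarrow> 0"
    by (rule P.strong_law_bounded) (auto simp: indicator_def)
  moreover have "P.expectation (indicat_real (E i) \<circ> (\<lambda>w. w i)) = measure (N i) (E i)" for i
  proof -
    have "P.expectation (indicat_real (E i) \<circ> (\<lambda>w. w i))
        = (\<integral>x. indicat_real (E i) x \<partial>distr (PiM UNIV N) (N i) (\<lambda>w. w i))"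
      using E by (subst integral_distr[OF rv]) (auto simp: comp_def)
    also have "\<dots> = measure (N i) (E i)"
      using E sets.sets_into_space[OF E]
      by (simp add: distr_PiM_component prob Int_absorb2)
    finally show ?thesis .
  qed
  ultimately show ?thesis
    by simp
qed


section \<open>Limits of choice frequencies\<close>

text \<open>Countability serves twice: one null set suffices for the law of large numbers on the
  whole algebra, and a diagonal subsequence can be extracted. The algebra is an increasing union of
  finite ones, the m-th being generated by the first m sets of an enumeration.\<close>

lemma countable_generated_algebra:
  assumes "countable G" "G \<subseteq> Pow \<Omega>"
  obtains \<A> where "algebra \<Omega> \<A>" "countable \<A>" "G \<subseteq> \<A>" "\<A> \<subseteq> sigma_sets \<Omega> G"
proof -
  \<comment> \<open>\<Omega> is inserted so that the set to be enumerated is nonempty even if G is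
    empty.\<close>
  define g where "g = from_nat_into (insert \<Omega> G)"
  have g_range: "range g = insert \<Omega> G"
    unfolding g_def using assms(1) by (intro range_from_nat_into) auto
  have g_sets: "g i \<in> sigma_sets \<Omega> G" for i
  proof -
    have "g i \<in> insert \<Omega> G" using g_range by auto
    then show ?thesis by (auto intro: sigma_sets_top)
  qed
  \<comment> \<open>the atom of the algebra generated by \<open>g 0, \<dots>, g (m - 1)\<close> that contains \<open>x\<close> is coded by
    the set of those \<open>i < m\<close> with \<open>x \<in> g i\<close>\<close>
  define c where "c m x = {i. i < m \<and> x \<in> g i}" for m x
  define \<A> where "\<A> = (\<Union>m. (\<lambda>B. {x\<in>\<Omega>. c m x \<in> B}) ` Pow (Pow {..<m}))"
  have memI: "{x\<in>\<Omega>. c m x \<in> B} \<in> \<A>" for m B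
  proof -
    have "{x\<in>\<Omega>. c m x \<in> B} = {x\<in>\<Omega>. c m x \<in> B \<inter> Pow {..<m}}"
      by (auto simp: c_def)
    then show ?thesis
      unfolding \<A>_def by blast
  qed
  \<comment> \<open>The code of a point at level m' is the restriction of its code at level m, so
    the finite algebras increase with m and two members can be brought to a common level.\<close>
  have memE: "\<exists>B. A = {x\<in>\<Omega>. c m x \<in> B}" if "A \<in> (\<lambda>B. {x\<in>\<Omega>. c m' x \<in> B}) ` X" "m' \<le> m" for A m m' X
  proof -
    from that obtain B where "A = {x\<in>\<Omega>. c m' x \<in> B}" by auto
    moreover have "c m' x = c m x \<inter> {..<m'}" for x
      using that(2) by (auto simp: c_def)
    ultimately have "A = {x\<in>\<Omega>. c m x \<in> {y. y \<inter> {..<m'} \<in> B}}" by auto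
    then show ?thesis by blast
  qed
  have "algebra \<Omega> \<A>"
    unfolding algebra_iff_Un
  proof (intro conjI ballI)
    show "\<A> \<subseteq> Pow \<Omega>" by (auto simp: \<A>_def)
    show "{} \<in> \<A>" using memI[of 0 "{}"] by simp
    fix a assume a: "a \<in> \<A>"
    then obtain m B where "a = {x\<in>\<Omega>. c m x \<in> B}" by (auto simp: \<A>_def)
    then have "\<Omega> - a = {x\<in>\<Omega>. c m x \<in> - B}" by auto
    then show "\<Omega> - a \<in> \<A>" using memI by metis
    fix b assume b: "b \<in> \<A>"
    obtain m m' where m: "a \<in> (\<lambda>B. {x\<in>\<Omega>. c m x \<in> B}) ` Pow (Pow {..<m})"
        "b \<in> (\<lambda>B. {x\<in>\<Omega>. c m' x \<in> B}) ` Pow (Pow {..<m'})"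
      using a b unfolding \<A>_def by blast
    obtain B where "a = {x\<in>\<Omega>. c (max m m') x \<in> B}"
      using memE[OF m(1), of "max m m'"] by auto
    moreover obtain B' where "b = {x\<in>\<Omega>. c (max m m') x \<in> B'}"
      using memE[OF m(2), of "max m m'"] by auto
    ultimately have "a \<union> b = {x\<in>\<Omega>. c (max m m') x \<in> B \<union> B'}" by auto
    then show "a \<union> b \<in> \<A>" using memI by metis
  qed
  moreover have "countable \<A>"
    unfolding \<A>_def by (intro countable_UN countable_image) (auto intro: countable_finite)
  moreover have "G \<subseteq> \<A>"
  proof
    fix A assume "A \<in> G"
    then obtain i where i: "A = g i" using g_range by (metis insertCI rangeE)
    then have "A = {x\<in>\<Omega>. c (Suc i) x \<in> {y. i \<in> y}}"
      using \<open>A \<in> G\<close> assms(2) by (auto simp: c_def)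
    then show "A \<in> \<A>" using memI by metis
  qed
  moreover have "\<A> \<subseteq> sigma_sets \<Omega> G"
  proof
    fix A assume "A \<in> \<A>"
    then obtain m B where B: "B \<subseteq> Pow {..<m}" and A: "A = {x\<in>\<Omega>. c m x \<in> B}"
      by (auto simp: \<A>_def)
    interpret sigma_algebra \<Omega> "sigma_sets \<Omega> G"
      using assms(2) by (rule sigma_algebra_sigma_sets)
    \<comment> \<open>The atom with code b is a finite intersection of sets g i and complements; the
      extra index m with value \<Omega> keeps the index set nonempty when m = 0.\<close>
    have "A = (\<Union>b\<in>B. \<Omega> \<inter> (\<Inter>i\<in>insert m {..<m}. if i = m then \<Omega> else if i \<in> b then g i else \<Omega> - g i))"
      (is "_ = ?R")
    proof
      show "A \<subseteq> ?R" by (auto simp: A c_def)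
      show "?R \<subseteq> A"
      proof
        fix x assume "x \<in> ?R"
        then obtain b where b: "b \<in> B" "x \<in> \<Omega>" "\<And>i. i < m \<Longrightarrow> x \<in> (if i \<in> b then g i else \<Omega> - g i)"
          by (auto split: if_splits)
        have "b \<subseteq> {..<m}" using b(1) B by auto
        then have "i \<in> c m x \<longleftrightarrow> i \<in> b" for i
          using b(3)[of i] by (cases "i < m") (auto simp: c_def split: if_splits)
        then have "c m x = b" by blast
        then show "x \<in> A" using b by (simp add: A)
      qed
    qed
    also have "\<dots> \<in> sigma_sets \<Omega> G"
      using B g_sets by (intro finite_UN Int finite_INT) (auto intro: finite_subset[of _ "Pow {..<m}"])
    finally show "A \<in> sigma_sets \<Omega> G" .
  qed
  ultimately show ?thesis by (rule that)
qed

text \<open>Finite additivity is all that survives in a limit of frequencies. Countable additivity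
  is regained from the total: each f k is at most \<open>measure C\<close>, which tends to 0 along
  decreasing sets with empty intersection, and this continuity at the empty set is what
  Caratheodory's theorem asks for.\<close>

lemma additive_partition_densities:
  fixes C :: "'a measure" and f :: "'k \<Rightarrow> 'a set \<Rightarrow> real"
  assumes C: "prob_space C" and alg: "algebra (space C) \<A>"
    and gen: "sigma_sets (space C) \<A> = sets C" and K: "finite K"
    and nonneg: "\<And>k A. k \<in> K \<Longrightarrow> A \<in> \<A> \<Longrightarrow> 0 \<le> f k A"
    and add: "\<And>k A B. k \<in> K \<Longrightarrow> A \<in> \<A> \<Longrightarrow> B \<in> \<A> \<Longrightarrow> A \<inter> B = {} \<Longrightarrow> f k (A \<union> B) = f k A + f k B"
    and total: "\<And>A. A \<in> \<A> \<Longrightarrow> (\<Sum>k\<in>K. f k A) = measure C A"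
  obtains p :: "'k \<Rightarrow> 'a \<Rightarrow> real" where
    "\<And>k. p k \<in> borel_measurable C"
    "\<And>k x. k \<in> K \<Longrightarrow> 0 \<le> p k x \<and> p k x \<le> 1"
    "\<And>x. (\<Sum>k\<in>K. p k x) = 1"
    "\<And>k A. k \<in> K \<Longrightarrow> A \<in> \<A> \<Longrightarrow> (\<integral>\<^sup>+x\<in>A. ennreal (p k x) \<partial>C) = ennreal (f k A)"
proof -
  interpret C: prob_space C by fact
  interpret A: algebra "space C" \<A> by fact
  have \<A>_sets: "A \<in> sets C" if "A \<in> \<A>" for A
    using gen that by auto
  have le: "f k A \<le> measure C A" if "k \<in> K" "A \<in> \<A>" for k A
    unfolding total[OF that(2), symmetric] using K that nonneg by (intro member_le_sum) auto
  have "\<forall>k\<in>K. \<exists>N. sets N = sets C \<and> (\<forall>A\<in>\<A>. emeasure N A = ennreal (f k A))"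
  proof
    fix k assume k: "k \<in> K"
    have "\<exists>\<mu>. (\<forall>s\<in>\<A>. \<mu> s = ennreal (f k s)) \<and> measure_space (space C) (sigma_sets (space C) \<A>) \<mu>"
    proof (rule A.caratheodory_empty_continuous)
      show "positive \<A> (\<lambda>s. ennreal (f k s))"
        using add[OF k A.empty_sets A.empty_sets] by (simp add: positive_def)
      show "additive \<A> (\<lambda>s. ennreal (f k s))"
        using add[OF k] nonneg[OF k] by (auto simp: additive_def ennreal_plus)
      fix A :: "nat \<Rightarrow> 'a set" assume A: "range A \<subseteq> \<A>" "decseq A" "(\<Inter>i. A i) = {}"
      have "(\<lambda>i. measure C (A i)) \<longlonglongrightarrow> measure C (\<Inter>i. A i)"
        using A \<A>_sets by (intro C.finite_Lim_measure_decseq) auto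
      then have "(\<lambda>i. measure C (A i)) \<longlonglongrightarrow> 0"
        using A by simp
      moreover have "0 \<le> f k (A i)" "f k (A i) \<le> measure C (A i)" for i
        using A(1) nonneg[OF k, of "A i"] le[OF k, of "A i"] by blast+
      ultimately have "(\<lambda>i. f k (A i)) \<longlonglongrightarrow> 0"
        using tendsto_sandwich[of "\<lambda>_. 0" "\<lambda>i. f k (A i)" sequentially "\<lambda>i. measure C (A i)" 0]
        by simp
      from tendsto_ennrealI[OF this] show "(\<lambda>i. ennreal (f k (A i))) \<longlonglongrightarrow> 0"
        by simp
    qed simp
    then obtain \<mu> where \<mu>: "\<And>s. s \<in> \<A> \<Longrightarrow> \<mu> s = ennreal (f k s)" "measure_space (space C) (sets C) \<mu>"
      unfolding gen by blast
    have "emeasure (measure_of (space C) (sets C) \<mu>) A = \<mu> A" if "A \<in> sets C" for A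
      using \<mu>(2) that by (intro emeasure_measure_of_sigma) (simp_all add: measure_space_def)
    then have "\<forall>A\<in>\<A>. emeasure (measure_of (space C) (sets C) \<mu>) A = ennreal (f k A)"
      using \<mu>(1) \<A>_sets by simp
    moreover have "sets (measure_of (space C) (sets C) \<mu>) = sets C"
      by simp
    ultimately show "\<exists>N. sets N = sets C \<and> (\<forall>A\<in>\<A>. emeasure N A = ennreal (f k A))"
      by blast
  qed
  from bchoice[OF this] obtain N where N_sets: "\<And>k. k \<in> K \<Longrightarrow> sets (N k) = sets C"
    and N: "\<And>k A. k \<in> K \<Longrightarrow> A \<in> \<A> \<Longrightarrow> emeasure (N k) A = ennreal (f k A)"
    by blast
  have N_space: "space (N k) = space C" if "k \<in> K" for k
    using N_sets[OF that] by (rule sets_eq_imp_space_eq)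
  have N_fin: "finite_measure (N k)" if "k \<in> K" for k
    using N[OF that A.top] N_space[OF that] by (intro finite_measureI) simp
  \<comment> \<open>The identity is carried from the algebra to all of \<open>sets C\<close> by the
    pi-lambda argument; applied to null sets it gives absolute continuity.\<close>
  have N_total: "(\<Sum>k\<in>K. measure (N k) A) = measure C A" if "A \<in> sets C" for A
  proof -
    have "A \<in> sigma_sets (space C) \<A>" using that gen by simp
    with A.Int_stable A.space_closed show ?thesis
    proof (induction rule: sigma_sets_induct_disjoint)
      case (basic A)
      then show ?case
        using total[OF basic] N[OF _ basic] nonneg[OF _ basic] by (simp add: measure_def)
    next
      case (compl A)
      then have A: "A \<in> sets C" using gen by simp
      have "(\<Sum>k\<in>K. measure (N k) (space C - A)) = (\<Sum>k\<in>K. measure (N k) (space C) - measure (N k) A)"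
        using A by (intro sum.cong refl)
          (simp add: N_sets N_space[symmetric] finite_measure.finite_measure_compl[OF N_fin])
      also have "\<dots> = (\<Sum>k\<in>K. measure (N k) (space C)) - measure C A"
        by (simp add: sum_subtractf compl)
      also have "(\<Sum>k\<in>K. measure (N k) (space C)) = measure C (space C)"
        using total[OF A.top] N[OF _ A.top] nonneg[OF _ A.top] by (simp add: measure_def)
      finally show ?case
        using A by (simp add: C.finite_measure_compl)
    next
      case (union A)
      then have A: "range A \<subseteq> sets C" using gen by auto
      have "(\<lambda>i. measure (N k) (A i)) sums measure (N k) (\<Union>i. A i)" if "k \<in> K" for k
        using A N_sets[OF that] union(1) by (intro finite_measure.finite_measure_UNION[OF N_fin[OF that]]) auto
      then have "(\<lambda>i. \<Sum>k\<in>K. measure (N k) (A i)) sums (\<Sum>k\<in>K. measure (N k) (\<Union>i. A i))"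
        by (rule sums_sum)
      moreover have "(\<lambda>i. measure C (A i)) sums measure C (\<Union>i. A i)"
        using A union(1) by (rule C.finite_measure_UNION)
      ultimately show ?case
        using union(3) sums_unique2 by simp
    qed simp
  qed
  define d where "d k = RN_deriv C (N k)" for k
  have d_meas [measurable]: "d k \<in> borel_measurable C" for k
    by (simp add: d_def)
  have d: "(\<integral>\<^sup>+x\<in>A. d k x \<partial>C) = emeasure (N k) A" if "k \<in> K" "A \<in> sets C" for k A
  proof -
    have "absolutely_continuous C (N k)"
      unfolding absolutely_continuous_def
    proof
      fix A assume A: "A \<in> null_sets C"
      then have "(\<Sum>k\<in>K. measure (N k) A) = 0"
        using N_total[of A] by (auto simp: measure_def null_sets_def)
      then have "measure (N k) A = 0"
        using K that(1) by (subst (asm) sum_nonneg_eq_0_iff) auto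
      then show "A \<in> null_sets (N k)"
        using A N_sets[OF that(1)] finite_measure.emeasure_eq_measure[OF N_fin[OF that(1)]]
        by (auto simp: null_sets_def)
    qed
    then have "density C (d k) = N k"
      unfolding d_def using N_sets[OF that(1)] by (rule C.density_RN_deriv)
    then show ?thesis
      using emeasure_density[OF d_meas that(2), of k] by simp
  qed
  have "AE x in C. (\<Sum>k\<in>K. d k x) = 1"
  proof (rule C.density_unique2)
    fix A assume A: "A \<in> sets C"
    have "(\<integral>\<^sup>+x\<in>A. (\<Sum>k\<in>K. d k x) \<partial>C) = (\<Sum>k\<in>K. \<integral>\<^sup>+x\<in>A. d k x \<partial>C)"
      using A by (subst nn_integral_sum[symmetric]) (auto simp: sum_distrib_right)
    also have "\<dots> = (\<Sum>k\<in>K. ennreal (measure (N k) A))"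
      using A by (intro sum.cong refl) (simp add: d finite_measure.emeasure_eq_measure[OF N_fin])
    also have "\<dots> = emeasure C A"
      using N_total[OF A] by (simp add: C.emeasure_eq_measure)
    finally show "(\<integral>\<^sup>+x\<in>A. (\<Sum>k\<in>K. d k x) \<partial>C) = (\<integral>\<^sup>+x\<in>A. 1 \<partial>C)"
      using A by simp
  qed auto
  moreover have "K \<noteq> {}"
    using total[OF A.top] C.prob_space by auto
  then obtain k0 where k0: "k0 \<in> K" by auto
  \<comment> \<open>The densities sum to 1 only almost everywhere. On the exceptional set all mass
    goes to k0, so that the sum is 1 at every point, as \<open>choice_vector\<close> demands;
    elsewhere each density is at most 1 and \<open>enn2real\<close> loses nothing.\<close>
  define p where "p k x = (if (\<Sum>k\<in>K. d k x) = 1 then enn2real (d k x) else of_bool (k = k0))" for k x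
  have d_le: "d k x \<le> 1" if "k \<in> K" "(\<Sum>k\<in>K. d k x) = 1" for k x
    using member_le_sum[of k K "\<lambda>k. d k x"] that K by simp
  have p_nonneg: "0 \<le> p k x" for k x
    by (simp add: p_def)
  have p_sum: "(\<Sum>k\<in>K. p k x) = 1" for x
  proof (cases "(\<Sum>k\<in>K. d k x) = 1")
    case True
    have "(\<Sum>k\<in>K. p k x) = (\<Sum>k\<in>K. enn2real (d k x))"
      using True by (simp add: p_def)
    also have "\<dots> = enn2real (\<Sum>k\<in>K. d k x)"
      using le_less_trans[OF d_le[OF _ True] ennreal_one_less_top] by (subst enn2real_sum) (simp_all add: comp_def)
    finally show ?thesis using True by simp
  next
    case False
    then show ?thesis using k0 K by (simp add: p_def)
  qed
  show ?thesis
  proof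
    show "p k \<in> borel_measurable C" for k
      unfolding p_def by measurable
    show "0 \<le> p k x \<and> p k x \<le> 1" if "k \<in> K" for k x
      using member_le_sum[of k K "\<lambda>k. p k x"] that K p_nonneg p_sum by simp
    show "(\<integral>\<^sup>+x\<in>A. ennreal (p k x) \<partial>C) = ennreal (f k A)" if "k \<in> K" "A \<in> \<A>" for k A
    proof -
      have "AE x in C. ennreal (p k x) = d k x"
        using \<open>AE x in C. (\<Sum>k\<in>K. d k x) = 1\<close>
      proof eventually_elim
        case (elim x)
        then show ?case
          using le_less_trans[OF d_le[OF that(1) elim] ennreal_one_less_top] by (simp add: p_def)
      qed
      then have "(\<integral>\<^sup>+x\<in>A. ennreal (p k x) \<partial>C) = (\<integral>\<^sup>+x\<in>A. d k x \<partial>C)"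
        by (intro nn_integral_cong_AE) auto
      then show ?thesis
        using that d \<A>_sets N by simp
    qed
  qed (rule p_sum)
qed

text \<open>No randomness is left here: u is one fixed sequence and the choices are arbitrary,
  possibly revised for each n. The link between them and C is that summing the joint frequencies
  over k forgets the choice and leaves the frequency of A along u, whose limit is known.\<close>

lemma limiting_choices:
  fixes C :: "'a measure" and \<pi> :: "nat \<Rightarrow> nat \<Rightarrow> 'k"
  assumes C: "prob_space C" and alg: "algebra (space C) \<A>" and cnt: "countable \<A>"
    and gen: "sigma_sets (space C) \<A> = sets C" and K: "finite K"
    and freq: "\<And>A. A \<in> \<A> \<Longrightarrow> (\<lambda>n. (\<Sum>i<n. indicat_real A (u i)) / real n) \<longlonglongrightarrow> measure C A"
    and \<pi>: "\<And>n i. i < n \<Longrightarrow> \<pi> n i \<in> K" and s: "strict_mono s"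
  obtains p :: "'k \<Rightarrow> 'a \<Rightarrow> real" and r :: "nat \<Rightarrow> nat" where
    "strict_mono r"
    "\<And>k. p k \<in> borel_measurable C"
    "\<And>k x. k \<in> K \<Longrightarrow> 0 \<le> p k x \<and> p k x \<le> 1"
    "\<And>x. (\<Sum>k\<in>K. p k x) = 1"
    "\<And>k A. k \<in> K \<Longrightarrow> A \<in> \<A> \<Longrightarrow>
      (\<lambda>n. (\<Sum>i<s (r n). indicat_real A (u i) * of_bool (\<pi> (s (r n)) i = k)) / real (s (r n)))
        \<longlonglongrightarrow> enn2real (\<integral>\<^sup>+x\<in>A. ennreal (p k x) \<partial>C)"
proof -
  interpret A: algebra "space C" \<A> by fact
  define q where "q n = (\<lambda>(k, A). (\<Sum>i<n. indicat_real A (u i) * of_bool (\<pi> n i = k)) / real n)" for n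
  have q_nonneg: "0 \<le> q n (k, A)" for n k A
    by (simp add: q_def sum_nonneg)
  have q_le: "q n (k, A) \<le> 1" for n k A
  proof (cases "n = 0")
    case False
    have "(\<Sum>i<n. indicat_real A (u i) * of_bool (\<pi> n i = k)) \<le> (\<Sum>i<n. 1)"
      by (intro sum_mono) (auto simp: indicator_def)
    then show ?thesis using False by (simp add: q_def)
  qed (simp add: q_def)
  \<comment> \<open>\<open>function_convergent_subsequence\<close> is the diagonal argument:
    uniformly bounded functions on a countable set have a pointwise convergent subsequence.\<close>
  obtain r where r: "strict_mono r" "\<And>x. x \<in> K \<times> \<A> \<Longrightarrow> \<exists>l. (\<lambda>n. q (s (r n)) x) \<longlonglongrightarrow> l"
  proof (rule function_convergent_subsequence[of "K \<times> \<A>" "\<lambda>n. q (s n)" 1])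
    show "countable (K \<times> \<A>)"
      using K cnt by (simp add: countable_finite)
    show "norm (q (s n) x) \<le> 1" for n x
      using q_nonneg q_le by (cases x) (simp add: abs_le_iff order.trans[OF _ zero_le_one] del: One_nat_def)
  qed auto
  define f where "f k A = lim (\<lambda>n. q (s (r n)) (k, A))" for k A
  have f: "(\<lambda>n. q (s (r n)) (k, A)) \<longlonglongrightarrow> f k A" if "k \<in> K" "A \<in> \<A>" for k A
    using r(2)[of "(k, A)"] that limI unfolding f_def by fastforce
  have sr: "filterlim (\<lambda>n. s (r n)) sequentially sequentially"
    using strict_mono_o[OF s r(1)] by (auto dest: filterlim_subseq simp: comp_def)
  obtain p where p: "\<And>k. p k \<in> borel_measurable C" "\<And>k x. k \<in> K \<Longrightarrow> 0 \<le> p k x \<and> p k x \<le> (1::real)"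
      "\<And>x. (\<Sum>k\<in>K. p k x) = 1"
      "\<And>k A. k \<in> K \<Longrightarrow> A \<in> \<A> \<Longrightarrow> (\<integral>\<^sup>+x\<in>A. ennreal (p k x) \<partial>C) = ennreal (f k A)"
  proof (rule additive_partition_densities[OF C alg gen K, of f])
    show nonneg: "0 \<le> f k A" if "k \<in> K" "A \<in> \<A>" for k A
      using f[OF that] by (rule LIMSEQ_le_const) (use q_nonneg in auto)
    show "f k (A \<union> B) = f k A + f k B" if "k \<in> K" "A \<in> \<A>" "B \<in> \<A>" "A \<inter> B = {}" for k A B
    proof -
      have "q n (k, A \<union> B) = q n (k, A) + q n (k, B)" for n
        using that(4) by (simp add: q_def add_divide_distrib[symmetric] sum.distrib[symmetric]
            distrib_right[symmetric] indicator_add)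
      then have "(\<lambda>n. q (s (r n)) (k, A \<union> B)) \<longlonglongrightarrow> f k A + f k B"
        using tendsto_add[OF f[OF that(1,2)] f[OF that(1,3)]] by simp
      then show ?thesis
        using f[OF that(1) A.Un[OF that(2,3)]] LIMSEQ_unique by blast
    qed
    show "(\<Sum>k\<in>K. f k A) = measure C A" if "A \<in> \<A>" for A
    proof -
      have "(\<Sum>k\<in>K. q n (k, A)) = (\<Sum>i<n. indicat_real A (u i)) / real n" for n
      proof -
        have "(\<Sum>k\<in>K. q n (k, A)) = (\<Sum>i<n. \<Sum>k\<in>K. indicat_real A (u i) * of_bool (\<pi> n i = k)) / real n"
          by (subst sum.swap) (simp add: q_def sum_divide_distrib)
        also have "(\<Sum>i<n. \<Sum>k\<in>K. indicat_real A (u i) * of_bool (\<pi> n i = k)) = (\<Sum>i<n. indicat_real A (u i))"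
          using \<pi> K by (intro sum.cong refl) (simp add: sum_distrib_left[symmetric] of_bool_def)
        finally show ?thesis .
      qed
      then have "(\<lambda>n. \<Sum>k\<in>K. q (s (r n)) (k, A)) \<longlonglongrightarrow> measure C A"
        using filterlim_compose[OF freq[OF that] sr] by simp
      moreover have "(\<lambda>n. \<Sum>k\<in>K. q (s (r n)) (k, A)) \<longlonglongrightarrow> (\<Sum>k\<in>K. f k A)"
        using f that by (intro tendsto_sum) auto
      ultimately show ?thesis
        using LIMSEQ_unique by blast
    qed
  qed (rule that)
  show ?thesis
  proof (rule that[OF r(1) p(1-3)])
    fix k A assume kA: "k \<in> K" "A \<in> \<A>"
    have "0 \<le> f k A"
      using f[OF kA] by (rule LIMSEQ_le_const) (use q_nonneg in auto)
    then show "(\<lambda>n. (\<Sum>i<s (r n). indicat_real A (u i) * of_bool (\<pi> (s (r n)) i = k)) / real (s (r n)))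
        \<longlonglongrightarrow> enn2real (\<integral>\<^sup>+x\<in>A. ennreal (p k x) \<partial>C)"
      using f[OF kA] p(4)[OF kA] by (simp add: q_def)
  qed
qed


section \<open>Limits along paths\<close>

text \<open>The intersection with [0,1] keeps the set in \<open>sets unif\<close> for every real q,
  so that distribution functions can be evaluated anywhere; it is empty for q < 0.\<close>

definition ray :: "real \<Rightarrow> real set" where
  "ray q = {0..1} \<inter> {..q}"

lemma mem_ray [simp]: "x \<in> ray q \<longleftrightarrow> x \<in> {0..1} \<and> x \<le> q"
  by (simp add: ray_def)

lemma sets_unif_iff: "A \<in> sets unif \<longleftrightarrow> A \<in> sets borel \<and> A \<subseteq> {0..1}"
  by (auto simp: unif_def sets_restrict_space)

lemma ray_sets [simp]: "ray q \<in> sets unif"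
  by (auto simp: sets_unif_iff ray_def)

lemma M1_space: "\<nu> \<in> M1 \<Longrightarrow> space \<nu> = {0..1}"
  using sets_eq_imp_space_eq[of \<nu> unif] by (simp add: M1_def)

lemma space_cube_component: "u \<in> space (cube D) \<Longrightarrow> k \<in> {1..D} \<Longrightarrow> u k \<in> {0..1}"
  by (auto simp: cube_def space_PiM)

lemma measurable_cube_component: "k \<in> {1..D} \<Longrightarrow> (\<lambda>u. u k) \<in> measurable (cube D) unif"
  unfolding cube_def by (rule measurable_component_singleton)

lemma sets_cube_component:
  assumes "k \<in> {1..D}" "B \<in> sets unif"
  shows "{u\<in>space (cube D). u k \<in> B} \<in> sets (cube D)"
  using measurable_sets[OF measurable_cube_component[OF assms(1)] assms(2)]
  by (simp add: vimage_def Int_def conj_commute)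

section \<open>Laws of single-edge strategies\<close>

lemma measurable_single_edge_label:
  "(\<lambda>(u, j). u j) \<in> measurable (cube D \<Otimes>\<^sub>M count_space {1..D}) unif"
proof -
  have "(\<lambda>z. fst z (snd z)) \<in> measurable (cube D \<Otimes>\<^sub>M count_space {1..D}) unif"
  proof (rule measurable_compose_countable'[where I = "{1..D}"])
    show "(\<lambda>z. fst z k) \<in> measurable (cube D \<Otimes>\<^sub>M count_space {1..D}) unif" if "k \<in> {1..D}" for k
      using measurable_fst measurable_cube_component[OF that] by (rule measurable_compose)
  qed simp_all
  then show ?thesis
    by (simp add: case_prod_beta')
qed

lemma measurable_single_edge_label':
  "single_edge_strategy D \<psi> \<Longrightarrow> (\<lambda>(u, j). u j) \<in> measurable \<psi> unif"
  using measurable_single_edge_label measurable_cong_sets[of \<psi> "cube D \<Otimes>\<^sub>M count_space {1..D}" unif unif]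
  by (auto simp: single_edge_strategy_def)

lemma sigma_law_in_M1:
  assumes "choice_vector D p"
  shows "sigma_law D p \<in> M1"
proof -
  have S: "single_edge_strategy D (single_edge_of D p)"
    using assms by (rule single_edge_strategy_of)
  then have "prob_space (sigma_law D p)"
    unfolding sigma_law_def single_edge_law_def
    by (intro prob_space.prob_space_distr measurable_single_edge_label')
       (auto simp: single_edge_strategy_def)
  then show ?thesis
    by (simp add: M1_def sigma_law_def single_edge_law_def)
qed

text \<open>Splitting by the chosen edge k produces exactly the integrals that arise as limits of
  the joint frequencies of labels and choices.\<close>

lemma emeasure_sigma_law:
  assumes p: "choice_vector D p" and B: "B \<in> sets unif"
  shows "emeasure (sigma_law D p) B
    = (\<Sum>k\<in>{1..D}. \<integral>\<^sup>+u\<in>{u\<in>space (cube D). u k \<in> B}. ennreal (p k u) \<partial>cube D)"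
proof -
  let ?C = "count_space {1..D}"
  interpret C: sigma_finite_measure ?C
    by (rule sigma_finite_measure_count_space_finite) simp
  let ?E = "(\<lambda>(u, j). u j) -` B \<inter> space (cube D \<Otimes>\<^sub>M ?C)"
  have E: "?E \<in> sets (cube D \<Otimes>\<^sub>M ?C)"
    using measurable_single_edge_label B by (rule measurable_sets)
  have meas: "(\<lambda>z. (case z of (u, k) \<Rightarrow> ennreal (p k u)) * indicator ?E z)
      \<in> borel_measurable (cube D \<Otimes>\<^sub>M ?C)"
    by (intro borel_measurable_times_ennreal measurable_choice_vector[OF p] borel_measurable_indicator E)
  have "emeasure (sigma_law D p) B = emeasure (single_edge_of D p) ?E"
    unfolding sigma_law_def single_edge_law_def
    using B measurable_single_edge_label'[OF single_edge_strategy_of[OF p]]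
    by (subst emeasure_distr) (auto simp: single_edge_of_def)
  also have "\<dots> = (\<integral>\<^sup>+z. (case z of (u, k) \<Rightarrow> ennreal (p k u)) * indicator ?E z \<partial>(cube D \<Otimes>\<^sub>M ?C))"
    unfolding single_edge_of_def by (rule emeasure_density) (rule measurable_choice_vector[OF p], rule E)
  also have "\<dots> = (\<integral>\<^sup>+u. \<integral>\<^sup>+k. ennreal (p k u) * indicator ?E (u, k) \<partial>?C \<partial>cube D)"
    by (subst C.nn_integral_fst[OF meas, symmetric]) simp
  also have "\<dots> = (\<integral>\<^sup>+u. (\<Sum>k\<in>{1..D}. ennreal (p k u) * indicator {u\<in>space (cube D). u k \<in> B} u) \<partial>cube D)"
    by (intro nn_integral_cong)
       (auto simp: nn_integral_count_space_finite space_pair_measure indicator_def intro!: sum.cong)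
  also have "\<dots> = (\<Sum>k\<in>{1..D}. \<integral>\<^sup>+u\<in>{u\<in>space (cube D). u k \<in> B}. ennreal (p k u) \<partial>cube D)"
  proof (rule nn_integral_sum)
    fix k assume k: "k \<in> {1..D}"
    then have "p k \<in> borel_measurable (cube D)"
      using p by (simp add: choice_vector_def)
    then show "(\<lambda>u. ennreal (p k u) * indicator {u\<in>space (cube D). u k \<in> B} u) \<in> borel_measurable (cube D)"
      using sets_cube_component[OF k B] by measurable
  qed
  finally show ?thesis .
qed

text \<open>Rational thresholds keep the generating family countable. It suffices that every
  coordinate is measurable for the generated sigma-algebra, since then the identity map into the
  product is measurable.\<close>

lemma sigma_sets_cube:
  "sigma_sets (space (cube D))
     {{u\<in>space (cube D). u k \<in> ray (of_rat q)} | k q. k \<in> {1..D}} = sets (cube D)"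
    (is "sigma_sets ?\<Omega> ?G = _")
proof
  show "sigma_sets ?\<Omega> ?G \<subseteq> sets (cube D)"
    using sets_cube_component ray_sets by (intro sets.sigma_sets_subset) blast
  have G: "?G \<subseteq> Pow ?\<Omega>" by blast
  define N where "N = sigma ?\<Omega> ?G"
  have sN: "space N = ?\<Omega>" "sets N = sigma_sets ?\<Omega> ?G"
    using G by (simp_all add: N_def)
  have comp: "(\<lambda>u. u k) \<in> measurable N unif" if k: "k \<in> {1..D}" for k
    unfolding unif_def
  proof (rule measurable_restrict_space2)
    show "(\<lambda>u. u k) \<in> space N \<rightarrow> {0..1}"
      using space_cube_component[OF _ k] sN by auto
    have "{u\<in>space N. u k \<le> a} \<in> sets N" for a
    proof -
      \<comment> \<open>A witness that the countable intersection over rationals above a has a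
        nonempty index set.\<close>
      obtain q0 where rat: "a < of_rat q0"
        using of_rat_dense[of a "a + 1"] by auto
      have "{u\<in>space N. u k \<le> a} = (\<Inter>q\<in>{q. a < of_rat q}. {u\<in>?\<Omega>. u k \<in> ray (of_rat q)})"
      proof (intro set_eqI iffI)
        fix u assume u: "u \<in> (\<Inter>q\<in>{q. a < of_rat q}. {u\<in>?\<Omega>. u k \<in> ray (of_rat q)})"
        have "u k \<le> a"
        proof (rule ccontr)
          assume "\<not> u k \<le> a"
          then obtain q where "a < of_rat q" "of_rat q < u k"
            using of_rat_dense[of a "u k"] by auto
          then show False using u by auto
        qed
        moreover have "u \<in> ?\<Omega>" using u rat by auto
        ultimately show "u \<in> {u\<in>space N. u k \<le> a}" using sN by simp
      qed (use space_cube_component[OF _ k] sN in auto)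
      also have "\<dots> \<in> sets N"
      proof (intro sets.countable_INT')
        show "{q. a < of_rat q} \<noteq> {}" using rat by blast
        have "{u\<in>?\<Omega>. u k \<in> ray (of_rat q)} \<in> sets N" for q
          unfolding sN using k by (intro sigma_sets.Basic) blast
        then show "(\<lambda>q. {u\<in>?\<Omega>. u k \<in> ray (of_rat q)}) ` {q. a < of_rat q} \<subseteq> sets N"
          by blast
      qed simp
      finally show ?thesis .
    qed
    then show "(\<lambda>u. u k) \<in> measurable N lborel"
      by (simp add: borel_measurable_iff_le)
  qed
  have "(\<lambda>u. u) \<in> measurable N (cube D)"
    unfolding cube_def
    using comp sN by (intro measurable_PiM_single') (auto simp: cube_def space_PiM)
  then have "A \<in> sets N" if "A \<in> sets (cube D)" for A
    using measurable_sets[of "\<lambda>u. u" N "cube D" A] that sets.sets_into_space[OF that] sN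
    by (simp add: Int_absorb2)
  then show "sets (cube D) \<subseteq> sigma_sets ?\<Omega> ?G"
    using sN by auto
qed

text \<open>The empirical distribution function as a plain real function of the labels, whose
  measurability is evident. It is the mass that \<open>empirical\<close> gives to
  \<open>ray q\<close> as soon as the labels lie in [0,1].\<close>

definition ecdf :: "(nat \<Rightarrow> real) \<Rightarrow> nat \<Rightarrow> real \<Rightarrow> real" where
  "ecdf x n q = (\<Sum>i<n. of_bool (x i \<le> q)) / real n"

lemma AE_environment_frequency:
  assumes "A \<in> sets (cube D)"
  shows "AE u in environment D. (\<lambda>n. (\<Sum>i<n. indicat_real A (u i)) / real n) \<longlonglongrightarrow> measure (cube D) A"
proof -
  have "AE u in environment D.
      (\<lambda>n. ((\<Sum>i<n. indicat_real A (u i)) - (\<Sum>i<n. measure (cube D) A)) / real n) \<longlonglongrightarrow> 0"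
    unfolding environment_def using assms by (intro strong_law_PiM prob_space_cube)
  then show ?thesis
  proof eventually_elim
    case (elim u)
    have "(\<lambda>n. ((\<Sum>i<n. indicat_real A (u i)) - (\<Sum>i<n. measure (cube D) A)) / real n + measure (cube D) A)
        \<longlonglongrightarrow> 0 + measure (cube D) A"
      using elim by (intro tendsto_add tendsto_const)
    then have "(\<lambda>n. ((\<Sum>i<n. indicat_real A (u i)) - (\<Sum>i<n. measure (cube D) A)) / real n + measure (cube D) A)
        \<longlonglongrightarrow> measure (cube D) A"
      by simp
    moreover have "eventually (\<lambda>n. ((\<Sum>i<n. indicat_real A (u i)) - (\<Sum>i<n. measure (cube D) A)) / real n
        + measure (cube D) A = (\<Sum>i<n. indicat_real A (u i)) / real n) sequentially"
      using eventually_gt_at_top[of 0] by eventually_elim (simp add: diff_divide_distrib)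
    ultimately show ?case
      by (rule Lim_transform_eventually)
  qed
qed

text \<open>The preimages of rational rays are among the generators of the algebra, so convergence
  holds at every rational point without any appeal to continuity points of the limit.\<close>

lemma AE_path_limits:
  "AE u in environment D. \<forall>\<pi> (s :: nat \<Rightarrow> nat). (\<forall>n. \<forall>i<n. \<pi> n i \<in> {1..D}) \<longrightarrow> strict_mono s \<longrightarrow>
    (\<exists>p r. choice_vector D p \<and> strict_mono r \<and>
      (\<forall>q::rat. (\<lambda>n. ecdf (observed (u, \<pi> (s (r n)))) (s (r n)) (of_rat q))
        \<longlonglongrightarrow> measure (sigma_law D p) (ray (of_rat q))))"
proof -
  let ?\<Omega> = "space (cube D)"
  let ?G = "{{u\<in>?\<Omega>. u k \<in> ray (of_rat q)} | k q. k \<in> {1..D}}"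
  have "?G = (\<lambda>(k, q). {u\<in>?\<Omega>. u k \<in> ray (of_rat q)}) ` ({1..D} \<times> UNIV)"
    by auto
  then have "countable ?G" by simp
  then obtain \<A> where alg: "algebra ?\<Omega> \<A>" and cnt: "countable \<A>" and G: "?G \<subseteq> \<A>"
      and sub: "\<A> \<subseteq> sigma_sets ?\<Omega> ?G"
    by (rule countable_generated_algebra) auto
  have gen: "sigma_sets ?\<Omega> \<A> = sets (cube D)"
    using sigma_sets_mono[OF sub] sigma_sets_subseteq[OF G, of ?\<Omega>] sigma_sets_cube[of D] by simp
  have "AE u in environment D. \<forall>A\<in>\<A>.
      (\<lambda>n. (\<Sum>i<n. indicat_real A (u i)) / real n) \<longlonglongrightarrow> measure (cube D) A"
    using cnt gen by (intro AE_ball_countable' AE_environment_frequency) auto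
  with AE_space show ?thesis
  proof eventually_elim
    case (elim u)
    have u: "u i \<in> ?\<Omega>" for i
      using elim(1) by (auto simp: environment_def space_PiM)
    show ?case
    proof (intro allI impI)
      fix \<pi> :: "nat \<Rightarrow> nat \<Rightarrow> nat" and s :: "nat \<Rightarrow> nat"
      assume \<pi>: "\<forall>n. \<forall>i<n. \<pi> n i \<in> {1..D}" and s: "strict_mono s"
      obtain p r where r: "strict_mono r" and p: "\<And>k. p k \<in> borel_measurable (cube D)"
          "\<And>k x. k \<in> {1..D} \<Longrightarrow> 0 \<le> p k x \<and> p k x \<le> (1::real)" "\<And>x. (\<Sum>k\<in>{1..D}. p k x) = 1"
        and lim: "\<And>k A. k \<in> {1..D} \<Longrightarrow> A \<in> \<A> \<Longrightarrow>
          (\<lambda>n. (\<Sum>i<s (r n). indicat_real A (u i) * of_bool (\<pi> (s (r n)) i = k)) / real (s (r n)))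
            \<longlonglongrightarrow> enn2real (\<integral>\<^sup>+x\<in>A. ennreal (p k x) \<partial>cube D)"
      proof (rule limiting_choices[OF prob_space_cube alg cnt gen finite_atLeastAtMost _ _ s])
        show "(\<lambda>n. (\<Sum>i<n. indicat_real A (u i)) / real n) \<longlonglongrightarrow> measure (cube D) A" if "A \<in> \<A>" for A
          using elim(2) that by blast
        show "\<pi> n i \<in> {1..D}" if "i < n" for n i
          using \<pi> that by blast
      qed (rule that)
      have cv: "choice_vector D p"
        unfolding choice_vector_def using p by blast
      have "(\<lambda>n. ecdf (observed (u, \<pi> (s (r n)))) (s (r n)) (of_rat q))
          \<longlonglongrightarrow> measure (sigma_law D p) (ray (of_rat q))" for q :: rat
      proof -
        define A where "A k = {u\<in>?\<Omega>. u k \<in> ray (of_rat q)}" for k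
        have A: "A k \<in> \<A>" if "k \<in> {1..D}" for k
          using G that unfolding A_def by blast
        have "ecdf (observed (u, \<pi> n)) n (of_rat q)
            = (\<Sum>k\<in>{1..D}. (\<Sum>i<n. indicat_real (A k) (u i) * of_bool (\<pi> n i = k)) / real n)" for n
        proof -
          have "(\<Sum>k\<in>{1..D}. \<Sum>i<n. indicat_real (A k) (u i) * of_bool (\<pi> n i = k))
              = (\<Sum>i<n. \<Sum>k\<in>{1..D}. indicat_real (A k) (u i) * of_bool (\<pi> n i = k))"
            by (rule sum.swap)
          also have "\<dots> = (\<Sum>i<n. of_bool (u i (\<pi> n i) \<le> of_rat q))"
          proof (rule sum.cong[OF refl])
            fix i assume "i \<in> {..<n}"
            then have "\<pi> n i \<in> {1..D}" using \<pi> by auto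
            then have "(\<Sum>k\<in>{1..D}. indicat_real (A k) (u i) * of_bool (\<pi> n i = k)) = indicat_real (A (\<pi> n i)) (u i)"
              by (simp add: of_bool_def if_distrib[of "\<lambda>x. _ * x"] cong: if_cong)
            also have "\<dots> = of_bool (u i (\<pi> n i) \<le> of_rat q)"
              using space_cube_component[OF u \<open>\<pi> n i \<in> {1..D}\<close>] u by (auto simp: A_def indicator_def)
            finally show "(\<Sum>k\<in>{1..D}. indicat_real (A k) (u i) * of_bool (\<pi> n i = k))
                = of_bool (u i (\<pi> n i) \<le> of_rat q)" .
          qed
          finally show ?thesis
            by (simp add: ecdf_def observed_def sum_divide_distrib[symmetric])
        qed
        moreover have "measure (sigma_law D p) (ray (of_rat q))
            = (\<Sum>k\<in>{1..D}. enn2real (\<integral>\<^sup>+x\<in>A k. ennreal (p k x) \<partial>cube D))"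
        proof -
          have fin: "(\<integral>\<^sup>+x\<in>A k. ennreal (p k x) \<partial>cube D) < top" if "k \<in> {1..D}" for k
          proof -
            have "(\<integral>\<^sup>+x\<in>A k. ennreal (p k x) \<partial>cube D) \<le> (\<integral>\<^sup>+x. 1 \<partial>cube D)"
              using p(2)[OF that] by (intro nn_integral_mono) (auto simp: indicator_def)
            also have "\<dots> = 1"
              using prob_space.emeasure_space_1[OF prob_space_cube] by simp
            finally show ?thesis using le_less_trans by fastforce
          qed
          from emeasure_sigma_law[OF cv ray_sets]
          have "emeasure (sigma_law D p) (ray (of_rat q)) = (\<Sum>k\<in>{1..D}. \<integral>\<^sup>+x\<in>A k. ennreal (p k x) \<partial>cube D)"
            by (simp only: A_def)
          then have "measure (sigma_law D p) (ray (of_rat q))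
              = enn2real (\<Sum>k\<in>{1..D}. \<integral>\<^sup>+x\<in>A k. ennreal (p k x) \<partial>cube D)"
            by (simp only: measure_def)
          also have "\<dots> = (\<Sum>k\<in>{1..D}. enn2real (\<integral>\<^sup>+x\<in>A k. ennreal (p k x) \<partial>cube D))"
            using fin by (subst enn2real_sum) (simp_all add: comp_def)
          finally show ?thesis .
        qed
        ultimately show ?thesis
          using lim A by (auto intro!: tendsto_sum)
      qed
      then show "\<exists>p r. choice_vector D p \<and> strict_mono r \<and>
          (\<forall>q::rat. (\<lambda>n. ecdf (observed (u, \<pi> (s (r n)))) (s (r n)) (of_rat q))
            \<longlonglongrightarrow> measure (sigma_law D p) (ray (of_rat q)))"
        using cv r by blast
    qed
  qed
qed


section \<open>Convergence of measures on the unit interval\<close>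

lemma M1_prob_space: "\<nu> \<in> M1 \<Longrightarrow> prob_space \<nu>"
  and M1_sets: "\<nu> \<in> M1 \<Longrightarrow> sets \<nu> = sets unif"
  by (simp_all add: M1_def)

lemma measure_M1_mono:
  "\<nu> \<in> M1 \<Longrightarrow> B \<in> sets unif \<Longrightarrow> A \<subseteq> B \<Longrightarrow> measure \<nu> A \<le> measure \<nu> B"
  using finite_measure.finite_measure_mono[OF prob_space.finite_measure[OF M1_prob_space]] M1_sets
  by blast

lemma measure_ray_mono: "\<nu> \<in> M1 \<Longrightarrow> a \<le> b \<Longrightarrow> measure \<nu> (ray a) \<le> measure \<nu> (ray b)"
  by (rule measure_M1_mono) auto

lemma measure_ray_right_continuous:
  assumes "\<nu> \<in> M1"
  shows "(\<lambda>n. measure \<nu> (ray (a + 1 / real (Suc n)))) \<longlonglongrightarrow> measure \<nu> (ray a)"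
proof -
  interpret prob_space \<nu> using assms by (rule M1_prob_space)
  have "ray (a + 1 / real (Suc n)) \<subseteq> ray (a + 1 / real (Suc m))" if "m \<le> n" for m n
  proof -
    have "1 / real (Suc n) \<le> 1 / real (Suc m)"
      using that by (intro divide_left_mono) auto
    then show ?thesis
      by (simp add: subset_iff del: of_nat_Suc)
  qed
  then have dec: "decseq (\<lambda>n. ray (a + 1 / real (Suc n)))"
    by (simp add: decseq_def)
  have "range (\<lambda>n. ray (a + 1 / real (Suc n))) \<subseteq> events"
    using M1_sets[OF assms] by (simp add: image_subset_iff)
  then have "(\<lambda>n. measure \<nu> (ray (a + 1 / real (Suc n)))) \<longlonglongrightarrow> measure \<nu> (\<Inter>n. ray (a + 1 / real (Suc n)))"
    using dec by (rule finite_Lim_measure_decseq)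
  also have "(\<Inter>n. ray (a + 1 / real (Suc n))) = ray a"
  proof
    show "(\<Inter>n. ray (a + 1 / real (Suc n))) \<subseteq> ray a"
    proof
      fix x assume x: "x \<in> (\<Inter>n. ray (a + 1 / real (Suc n)))"
      have "x \<le> a"
      proof (rule field_le_epsilon)
        fix e :: real assume "e > 0"
        then obtain n where "1 / real (Suc n) < e" using nat_approx_posE by blast
        moreover have "x \<le> a + 1 / real (Suc n)" using x by auto
        ultimately show "x \<le> a + e" by simp
      qed
      then show "x \<in> ray a" using x by auto
    qed
    show "ray a \<subseteq> (\<Inter>n. ray (a + 1 / real (Suc n)))"
      by (simp add: subset_iff add_increasing2)
  qed
  finally show ?thesis .
qed

lemma measure_empirical_ray:
  assumes "\<And>i. i < n \<Longrightarrow> x i \<in> {0..1}"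
  shows "measure (empirical x n) (ray q) = ecdf x n q"
proof (cases "n = 0")
  case True
  then show ?thesis
    by (simp add: measure_def emeasure_empirical ecdf_def)
next
  case False
  have "(\<Sum>i<n. indicator (ray q) (x i)) = (\<Sum>i<n. ennreal (of_bool (x i \<le> q)))"
    using assms by (intro sum.cong refl) (auto simp: indicator_def)
  then have "emeasure (empirical x n) (ray q) = (\<Sum>i<n. ennreal (of_bool (x i \<le> q))) / of_nat n"
    using emeasure_empirical[OF ray_sets, of x n q] by (simp only:)
  also have "\<dots> = ennreal (\<Sum>i<n. of_bool (x i \<le> q)) / ennreal (real n)"
    unfolding ennreal_of_nat_eq_real_of_nat by (intro arg_cong2[where f = "(/)"] sum_ennreal refl) simp
  also have "\<dots> = ennreal (ecdf x n q)"
    unfolding ecdf_def using False by (intro divide_ennreal sum_nonneg) auto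
  finally show ?thesis
    by (simp add: measure_def ecdf_def sum_nonneg)
qed

text \<open>Both weak convergence and convergence in the Levy-Prokhorov metric imply \<open>interlaced\<close>, and it
  determines the limit.\<close>

definition interlaced :: "(nat \<Rightarrow> real measure) \<Rightarrow> real measure \<Rightarrow> bool" where
  "interlaced \<mu> \<nu> \<longleftrightarrow> (\<forall>a b \<epsilon>. a < b \<longrightarrow> 0 < \<epsilon> \<longrightarrow> eventually (\<lambda>n.
     measure \<nu> (ray a) \<le> measure (\<mu> n) (ray b) + \<epsilon> \<and>
     measure (\<mu> n) (ray a) \<le> measure \<nu> (ray b) + \<epsilon>) sequentially)"

lemma M1_eqI:
  assumes "\<nu> \<in> M1" "\<sigma> \<in> M1" and eq: "\<And>a. measure \<nu> (ray a) = measure \<sigma> (ray a)"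
  shows "\<nu> = \<sigma>"
proof -
  have meas: "(\<lambda>x. x) \<in> measurable \<rho> borel" if "\<rho> \<in> M1" for \<rho>
    using that by (intro measurableI) (auto simp: M1_space M1_sets sets_unif_iff vimage_def Int_def)
  have d: "measure (distr \<rho> borel (\<lambda>x. x)) A = measure \<rho> ({0..1} \<inter> A)" if "\<rho> \<in> M1" "A \<in> sets borel" for \<rho> A
    using meas[OF that(1)] that by (subst measure_distr) (auto simp: M1_space Int_commute)
  have rd: "real_distribution (distr \<rho> borel (\<lambda>x. x))" if "\<rho> \<in> M1" for \<rho>
    using prob_space.prob_space_distr[OF M1_prob_space[OF that] meas[OF that]]
    by (simp add: real_distribution_def real_distribution_axioms_def)
  have cdf: "cdf (distr \<rho> borel (\<lambda>x. x)) a = measure \<rho> (ray a)" if "\<rho> \<in> M1" for \<rho> a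
    unfolding cdf_def ray_def by (simp only: d[OF that atMost_borel])
  have "distr \<nu> borel (\<lambda>x. x) = distr \<sigma> borel (\<lambda>x. x)"
    using assms(1,2) eq by (intro cdf_unique rd ext) (simp_all only: cdf)
  then have "measure \<nu> A = measure \<sigma> A" if "A \<in> sets unif" for A
    using d[OF assms(1), of A] d[OF assms(2), of A] that by (simp add: sets_unif_iff Int_absorb1)
  then show ?thesis
    using assms M1_sets finite_measure.emeasure_eq_measure[OF prob_space.finite_measure[OF M1_prob_space]]
    by (intro measure_eqI) auto
qed

text \<open>For a < b a rational point between them is compared with both measures, which gives F(a)
  \<le> G(b) and G(a) \<le> F(b) for the two distribution functions; right continuity then lets b
  decrease to a.\<close>

lemma interlaced_unique:
  assumes inter: "interlaced \<mu> \<nu>" and M1: "\<nu> \<in> M1" "\<sigma> \<in> M1"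
    and lim: "\<And>q::rat. (\<lambda>n. measure (\<mu> n) (ray (of_rat q))) \<longlonglongrightarrow> measure \<sigma> (ray (of_rat q))"
  shows "\<nu> = \<sigma>"
proof (rule M1_eqI[OF M1])
  have le: "measure \<nu> (ray a) \<le> measure \<sigma> (ray b) \<and> measure \<sigma> (ray a) \<le> measure \<nu> (ray b)"
    if "a < b" for a b
  proof -
    obtain q where q: "a < of_rat q" "of_rat q < b"
      using of_rat_dense[OF \<open>a < b\<close>] by blast
    have "measure \<nu> (ray a) \<le> measure \<sigma> (ray (of_rat q))"
    proof (rule field_le_epsilon)
      fix e :: real assume "e > 0"
      from inter[unfolded interlaced_def, rule_format, OF q(1) this]
      have "eventually (\<lambda>n. measure \<nu> (ray a) \<le> measure (\<mu> n) (ray (of_rat q)) + e) sequentially"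
        by (rule eventually_mono) simp
      then show "measure \<nu> (ray a) \<le> measure \<sigma> (ray (of_rat q)) + e"
        by (intro tendsto_lowerbound[OF tendsto_add[OF lim tendsto_const]]) auto
    qed
    moreover have "measure \<sigma> (ray (of_rat q)) \<le> measure \<nu> (ray b)"
    proof (rule field_le_epsilon)
      fix e :: real assume "e > 0"
      from inter[unfolded interlaced_def, rule_format, OF q(2) this]
      have "eventually (\<lambda>n. measure (\<mu> n) (ray (of_rat q)) \<le> measure \<nu> (ray b) + e) sequentially"
        by (rule eventually_mono) simp
      then show "measure \<sigma> (ray (of_rat q)) \<le> measure \<nu> (ray b) + e"
        by (intro tendsto_upperbound[OF lim]) auto
    qed
    ultimately show ?thesis
      using measure_ray_mono[OF M1(2), of a "of_rat q"] measure_ray_mono[OF M1(2), of "of_rat q" b] q by simp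
  qed
  show "measure \<nu> (ray a) = measure \<sigma> (ray a)" for a
    using le[of a] measure_ray_right_continuous[OF M1(1), of a] measure_ray_right_continuous[OF M1(2), of a]
    by (intro antisym LIMSEQ_le_const) auto
qed

lemma measurable_M1:
  assumes "\<nu> \<in> M1" "f \<in> borel_measurable borel"
  shows "f \<in> borel_measurable \<nu>"
proof -
  have "f \<in> borel_measurable unif"
    unfolding unif_def using assms(2) by (intro measurable_restrict_space1) simp
  then show ?thesis
    unfolding measurable_cong_sets[OF M1_sets[OF assms(1)] refl] .
qed

text \<open>Membership in \<open>M1\<close> is asked only eventually because the empirical measure
  of no points is the null measure.\<close>

lemma weakly_converges_interlaced:
  assumes weak: "weakly_converges \<mu> \<nu>" and \<nu>: "\<nu> \<in> M1" and \<mu>: "eventually (\<lambda>n. \<mu> n \<in> M1) sequentially"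
  shows "interlaced \<mu> \<nu>"
  unfolding interlaced_def
proof (intro allI impI)
  fix a b \<epsilon> :: real assume ab: "a < b" and \<epsilon>: "0 < \<epsilon>"
  \<comment> \<open>A continuous ramp, 1 up to a and 0 from b on, which lies between the indicators
    of the two rays on [0,1].\<close>
  define f where "f x = max 0 (min 1 ((b - x) / (b - a)))" for x
  have bounds: "measure \<rho> (ray a) \<le> (\<integral>x. f x \<partial>\<rho>)" "(\<integral>x. f x \<partial>\<rho>) \<le> measure \<rho> (ray b)" if \<rho>: "\<rho> \<in> M1" for \<rho>
  proof -
    interpret prob_space \<rho> using \<rho> by (rule M1_prob_space)
    have "f \<in> borel_measurable borel"
      unfolding f_def by measurable
    with \<rho> have "f \<in> borel_measurable \<rho>"
      by (rule measurable_M1)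
    then have int: "integrable \<rho> f"
      by (intro integrable_const_bound[where B = 1]) (auto simp: f_def)
    have ray: "ray c \<in> events" for c
      using M1_sets[OF \<rho>] by simp
    have int_ray: "(\<integral>x. indicator (ray c) x \<partial>\<rho>) = measure \<rho> (ray c)" for c
    proof -
      have "ray c \<inter> space \<rho> = ray c"
        using sets.sets_into_space[OF ray] by blast
      then show ?thesis by simp
    qed
    have int_ind: "integrable \<rho> (indicat_real (ray c))" for c
      using ray by (intro integrable_real_indicator) (simp_all add: emeasure_eq_measure)
    have "measure \<rho> (ray a) = (\<integral>x. indicator (ray a) x \<partial>\<rho>)"
      by (simp only: int_ray)
    also have "\<dots> \<le> (\<integral>x. f x \<partial>\<rho>)"
      using ab by (intro integral_mono int_ind int) (auto simp: f_def indicator_def)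
    finally show "measure \<rho> (ray a) \<le> (\<integral>x. f x \<partial>\<rho>)" .
    have "(\<integral>x. f x \<partial>\<rho>) \<le> (\<integral>x. indicator (ray b) x \<partial>\<rho>)"
      using ab M1_space[OF \<rho>] by (intro integral_mono int_ind int) (auto simp: f_def indicator_def divide_simps)
    also have "\<dots> = measure \<rho> (ray b)"
      by (rule int_ray)
    finally show "(\<integral>x. f x \<partial>\<rho>) \<le> measure \<rho> (ray b)" .
  qed
  have "continuous_on {0..1} f"
    unfolding f_def using ab by (intro continuous_intros) auto
  then have "(\<lambda>n. \<integral>x. f x \<partial>\<mu> n) \<longlonglongrightarrow> (\<integral>x. f x \<partial>\<nu>)"
    using weak unfolding weakly_converges_def by blast
  then have "eventually (\<lambda>n. dist (\<integral>x. f x \<partial>\<mu> n) (\<integral>x. f x \<partial>\<nu>) < \<epsilon>) sequentially"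
    using \<epsilon> by (rule tendstoD)
  with \<mu> show "eventually (\<lambda>n. measure \<nu> (ray a) \<le> measure (\<mu> n) (ray b) + \<epsilon> \<and>
     measure (\<mu> n) (ray a) \<le> measure \<nu> (ray b) + \<epsilon>) sequentially"
  proof eventually_elim
    case (elim n)
    then show ?case
      using bounds[OF \<nu>] bounds[OF elim(1)] by (auto simp: dist_real_def)
  qed
qed

section \<open>The Levy-Prokhorov metric\<close>

lemma nbhd_sets: "nbhd \<epsilon> A \<in> sets unif"
proof -
  have "nbhd \<epsilon> A = {0..1} \<inter> (\<Union>a\<in>A. ball a \<epsilon>)"
    by (auto simp: nbhd_def dist_commute)
  moreover have "open (\<Union>a\<in>A. ball a \<epsilon>)" by auto
  ultimately show ?thesis
    by (simp add: sets_unif_iff)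
qed

definition lp_bound :: "real measure \<Rightarrow> real measure \<Rightarrow> real \<Rightarrow> bool" where
  "lp_bound \<mu> \<nu> \<epsilon> \<longleftrightarrow> \<epsilon> > 0 \<and>
     (\<forall>A\<in>sets unif. measure \<mu> A \<le> measure \<nu> (nbhd \<epsilon> A) + \<epsilon> \<and>
                    measure \<nu> A \<le> measure \<mu> (nbhd \<epsilon> A) + \<epsilon>)"

lemma levy_prokhorov_eq: "levy_prokhorov \<mu> \<nu> = Inf {\<epsilon>. lp_bound \<mu> \<nu> \<epsilon>}"
  by (simp add: levy_prokhorov_def lp_bound_def)

text \<open>Guarantees that the infimum defining the metric runs over a nonempty set.\<close>

lemma lp_bound_1:
  assumes "\<mu> \<in> M1" "\<nu> \<in> M1"
  shows "lp_bound \<mu> \<nu> 1"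
proof -
  have "measure \<rho> A \<le> 1" if "\<rho> \<in> M1" for \<rho> A
    using prob_space.prob_le_1[OF M1_prob_space[OF that]] .
  then show ?thesis
    using assms unfolding lp_bound_def by (auto intro: add_increasing)
qed

lemma levy_prokhorov_nonneg: "\<mu> \<in> M1 \<Longrightarrow> \<nu> \<in> M1 \<Longrightarrow> 0 \<le> levy_prokhorov \<mu> \<nu>"
  unfolding levy_prokhorov_eq using lp_bound_1[of \<mu> \<nu>]
  by (intro cInf_greatest) (blast, simp add: lp_bound_def)

lemma levy_prokhorov_le: "lp_bound \<mu> \<nu> \<epsilon> \<Longrightarrow> levy_prokhorov \<mu> \<nu> \<le> \<epsilon>"
  unfolding levy_prokhorov_eq
  by (intro cInf_lower bdd_belowI[of _ 0]) (auto simp: lp_bound_def)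

lemma levy_prokhorov_interlaced:
  assumes LP: "(\<lambda>n. levy_prokhorov (\<mu> n) \<nu>) \<longlonglongrightarrow> 0" and \<nu>: "\<nu> \<in> M1"
    and \<mu>: "eventually (\<lambda>n. \<mu> n \<in> M1) sequentially"
  shows "interlaced \<mu> \<nu>"
  unfolding interlaced_def
proof (intro allI impI)
  fix a b \<epsilon> :: real assume ab: "a < b" and \<epsilon>: "0 < \<epsilon>"
  \<comment> \<open>A radius below b - a keeps the neighbourhood of \<open>ray a\<close> inside
    \<open>ray b\<close>; a radius below \<epsilon> controls the additive error.\<close>
  define \<delta> where "\<delta> = min \<epsilon> (b - a)"
  have "\<delta> > 0" using ab \<epsilon> by (simp add: \<delta>_def)
  with LP have "eventually (\<lambda>n. levy_prokhorov (\<mu> n) \<nu> < \<delta>) sequentially"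
    by (rule order_tendstoD(2))
  with \<mu> show "eventually (\<lambda>n. measure \<nu> (ray a) \<le> measure (\<mu> n) (ray b) + \<epsilon> \<and>
     measure (\<mu> n) (ray a) \<le> measure \<nu> (ray b) + \<epsilon>) sequentially"
  proof eventually_elim
    case (elim n)
    have "{\<epsilon>. lp_bound (\<mu> n) \<nu> \<epsilon>} \<noteq> {}"
      using lp_bound_1[OF elim(1) \<nu>] by auto
    from cInf_lessD[OF this elim(2)[unfolded levy_prokhorov_eq]]
    obtain \<eta> where \<eta>: "lp_bound (\<mu> n) \<nu> \<eta>" "\<eta> < \<delta>"
      by blast
    have "nbhd \<eta> (ray a) \<subseteq> ray b"
      using \<eta>(2) by (auto simp: nbhd_def \<delta>_def dist_real_def)
    then have "measure \<rho> (nbhd \<eta> (ray a)) \<le> measure \<rho> (ray b)" if "\<rho> \<in> M1" for \<rho>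
      using that by (intro measure_M1_mono) auto
    from this[OF \<nu>] this[OF elim(1)] \<eta> show ?case
      unfolding lp_bound_def \<delta>_def by (fastforce dest: bspec[of _ _ "ray a"])
  qed
qed

text \<open>For N > 0 these are the half-open intervals ((k - 1)/N, k/N] cut down to [0,1]. The
  subtraction takes place in the reals, so cell 0 is {0} and the N + 1 indices up to N cover the
  unit interval.\<close>

definition cell :: "nat \<Rightarrow> nat \<Rightarrow> real set" where
  "cell N k = ray (real k / real N) - ray ((real k - 1) / real N)"

lemma cell_sets [simp]: "cell N k \<in> sets unif"
  by (auto simp: cell_def)

lemma mem_cell_iff:
  assumes "N > 0"
  shows "x \<in> cell N k \<longleftrightarrow> x \<in> {0..1} \<and> \<lceil>real N * x\<rceil> = int k"
  using assms by (auto simp: cell_def ceiling_eq_iff field_simps)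

lemma ex_cell:
  assumes "N > 0" "x \<in> {0..1}"
  shows "\<exists>k\<le>N. x \<in> cell N k"
proof -
  have "real N * x \<le> real N" "0 \<le> real N * x"
    using assms by (auto simp: mult_left_le)
  then have "0 \<le> \<lceil>real N * x\<rceil>" "\<lceil>real N * x\<rceil> \<le> int N"
    by (auto simp: ceiling_le_iff)
  then show ?thesis
    using assms by (intro exI[of _ "nat \<lceil>real N * x\<rceil>"]) (auto simp: mem_cell_iff)
qed

lemma measure_cell:
  assumes "\<nu> \<in> M1" "N > 0"
  shows "measure \<nu> (cell N k) = measure \<nu> (ray (real k / real N)) - measure \<nu> (ray ((real k - 1) / real N))"
proof -
  interpret prob_space \<nu> using assms(1) by (rule M1_prob_space)
  have "(real k - 1) / real N \<le> real k / real N"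
    by (simp add: divide_right_mono)
  then have "ray ((real k - 1) / real N) \<subseteq> ray (real k / real N)"
    by auto
  then show ?thesis
    unfolding cell_def using M1_sets[OF assms(1)] by (intro finite_measure_Diff) auto
qed

text \<open>The cells that meet A cover it, and they lie in its neighbourhood because two points of
  one cell are less than 1/N apart. The error \<delta> is paid once for each of at most N + 1
  cells.\<close>

lemma measure_le_nbhd_of_cells:
  assumes M1: "\<mu> \<in> M1" "\<nu> \<in> M1" and N: "N > 0" and A: "A \<in> sets unif"
    and le: "\<And>k. k \<le> N \<Longrightarrow> measure \<mu> (cell N k) \<le> measure \<nu> (cell N k) + \<delta>"
    and "\<delta> \<ge> 0" "1 / real N \<le> \<epsilon>"
  shows "measure \<mu> A \<le> measure \<nu> (nbhd \<epsilon> A) + real (Suc N) * \<delta>"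
proof -
  interpret \<mu>: prob_space \<mu> using M1(1) by (rule M1_prob_space)
  interpret \<nu>: prob_space \<nu> using M1(2) by (rule M1_prob_space)
  define K where "K = {k. k \<le> N \<and> cell N k \<inter> A \<noteq> {}}"
  have K: "finite K" "card K \<le> Suc N" "K \<subseteq> {..N}"
    using card_mono[of "{..N}" K] by (auto simp: K_def)
  have U: "(\<Union>k\<in>K. cell N k) \<in> sets unif"
    using K by (intro sets.finite_UN) auto
  have "A \<subseteq> (\<Union>k\<in>K. cell N k)"
  proof
    fix x assume x: "x \<in> A"
    then have "x \<in> {0..1}" using A sets_unif_iff by blast
    then obtain k where "k \<le> N" "x \<in> cell N k" using ex_cell[OF N] by blast
    with x show "x \<in> (\<Union>k\<in>K. cell N k)" by (auto simp: K_def)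
  qed
  then have "measure \<mu> A \<le> measure \<mu> (\<Union>k\<in>K. cell N k)"
    using M1(1) U by (intro measure_M1_mono)
  also have "\<dots> \<le> (\<Sum>k\<in>K. measure \<mu> (cell N k))"
    using K M1_sets[OF M1(1)] by (intro \<mu>.finite_measure_subadditive_finite) auto
  also have "\<dots> \<le> (\<Sum>k\<in>K. measure \<nu> (cell N k) + \<delta>)"
    using K le by (intro sum_mono) auto
  also have "\<dots> = (\<Sum>k\<in>K. measure \<nu> (cell N k)) + real (card K) * \<delta>"
    by (simp add: sum.distrib)
  also have "(\<Sum>k\<in>K. measure \<nu> (cell N k)) = measure \<nu> (\<Union>k\<in>K. cell N k)"
    using K M1_sets[OF M1(2)] N
    by (intro \<nu>.finite_measure_finite_Union[symmetric]) (auto simp: disjoint_family_on_def mem_cell_iff)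
  also have "\<dots> \<le> measure \<nu> (nbhd \<epsilon> A)"
  proof (intro measure_M1_mono M1(2) nbhd_sets subsetI)
    fix x assume "x \<in> (\<Union>k\<in>K. cell N k)"
    then obtain k y where x: "x \<in> cell N k" and y: "y \<in> cell N k" "y \<in> A"
      by (auto simp: K_def)
    have "(real k - 1) / real N < x" "x \<le> real k / real N" "(real k - 1) / real N < y" "y \<le> real k / real N"
      using x y by (auto simp: cell_def)
    then have "dist x y < 1 / real N"
      by (simp add: dist_real_def diff_divide_distrib)
    then show "x \<in> nbhd \<epsilon> A"
      using x y(2) assms(7) unfolding nbhd_def cell_def by (auto intro!: bexI[of _ y])
  qed
  also have "real (card K) * \<delta> \<le> real (Suc N) * \<delta>"
    using K(2) \<open>\<delta> \<ge> 0\<close> by (intro mult_right_mono) auto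
  finally show ?thesis by simp
qed

text \<open>Each cell is a difference of two rays, so its mass is known up to 2/N^2; the N + 1 \<le>
  2N cells together cost at most 4/N.\<close>

lemma levy_prokhorov_le_of_cdf:
  assumes M1: "\<mu> \<in> M1" "\<nu> \<in> M1" and N: "N > 0"
    and close: "\<And>k. k \<le> N \<Longrightarrow>
      \<bar>measure \<mu> (ray (real k / real N)) - measure \<nu> (ray (real k / real N))\<bar> \<le> 1 / (real N)\<^sup>2"
  shows "levy_prokhorov \<mu> \<nu> \<le> 4 / real N"
proof (rule levy_prokhorov_le)
  have cells: "\<bar>measure \<mu> (cell N k) - measure \<nu> (cell N k)\<bar> \<le> 2 / (real N)\<^sup>2" if "k \<le> N" for k
  proof (cases k)
    case 0
    have "ray q = {}" if "q < 0" for q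
      using that by auto
    then show ?thesis
      using close[of 0] M1 N 0 by (simp add: measure_cell)
  next
    case (Suc j)
    then have "\<bar>measure \<mu> (cell N k) - measure \<nu> (cell N k)\<bar> \<le> 1 / (real N)\<^sup>2 + 1 / (real N)\<^sup>2"
      using close[of k] close[of j] that M1 N by (simp add: measure_cell)
    then show ?thesis by simp
  qed
  have "real (Suc N) * (2 / (real N)\<^sup>2) \<le> (2 * real N) * (2 / (real N)\<^sup>2)"
    using N by (intro mult_right_mono) auto
  also have "\<dots> = 4 / real N"
    using N by (simp add: power2_eq_square)
  finally have le: "real (Suc N) * (2 / (real N)\<^sup>2) \<le> 4 / real N" .
  have "1 / real N \<le> 4 / real N"
    by (intro divide_right_mono) auto
  then show "lp_bound \<mu> \<nu> (4 / real N)"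
    unfolding lp_bound_def
    using measure_le_nbhd_of_cells[OF M1 N, of _ "2 / (real N)\<^sup>2" "4 / real N"]
      measure_le_nbhd_of_cells[OF M1(2,1) N, of _ "2 / (real N)\<^sup>2" "4 / real N"] cells le N
    by (fastforce simp: abs_le_iff)
qed

text \<open>A step function constant on the cells replaces f at a cost of e/4 under each measure,
  and the masses of the cells converge because their endpoints are rational.\<close>

lemma weakly_converges_of_cdf:
  assumes \<sigma>: "\<sigma> \<in> M1" and \<mu>: "eventually (\<lambda>n. \<mu> n \<in> M1) sequentially"
    and lim: "\<And>q::rat. (\<lambda>n. measure (\<mu> n) (ray (of_rat q))) \<longlonglongrightarrow> measure \<sigma> (ray (of_rat q))"
  shows "weakly_converges \<mu> \<sigma>"
  unfolding weakly_converges_def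
proof (intro allI impI)
  fix f :: "real \<Rightarrow> real" assume f: "continuous_on {0..1} f"
  show "(\<lambda>n. \<integral>x. f x \<partial>\<mu> n) \<longlonglongrightarrow> (\<integral>x. f x \<partial>\<sigma>)"
  proof (rule tendstoI)
    fix e :: real assume "e > 0"
    have "uniformly_continuous_on {0..1} f"
      using f by (rule compact_uniformly_continuous) simp
    then obtain d where d: "d > 0" "\<And>x y. x \<in> {0..1} \<Longrightarrow> y \<in> {0..1} \<Longrightarrow> dist x y < d \<Longrightarrow> dist (f x) (f y) < e / 4"
      using \<open>e > 0\<close> unfolding uniformly_continuous_on_def by (metis zero_less_divide_iff zero_less_numeral)
    obtain M where "1 / real (Suc M) < d"
      using d(1) nat_approx_posE by blast
    then obtain N where N: "N > 0" "1 / real N < d" by blast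
    define g where "g x = (\<Sum>k\<le>N. f (real k / real N) * indicator (cell N k) x)" for x
    have g: "\<bar>f x - g x\<bar> \<le> e / 4" if x: "x \<in> {0..1}" for x
    proof -
      obtain k where k: "k \<le> N" "x \<in> cell N k" using ex_cell[OF N(1) x] by blast
      have "g x = (\<Sum>j\<le>N. if j = k then f (real k / real N) else 0)"
        unfolding g_def using k(2) N(1) by (intro sum.cong) (auto simp: mem_cell_iff indicator_def)
      also have "\<dots> = f (real k / real N)" using k(1) by simp
      finally have "g x = f (real k / real N)" .
      moreover have "dist x (real k / real N) < d"
        using k(2) N(2) by (auto simp: cell_def dist_real_def diff_divide_distrib)
      then have "dist (f x) (f (real k / real N)) < e / 4"
        using x k(1) N(1) by (intro d(2)) auto
      ultimately show ?thesis by (simp add: dist_real_def)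
    qed
    have integral_g: "\<bar>(\<integral>x. f x \<partial>\<rho>) - (\<Sum>k\<le>N. f (real k / real N) * measure \<rho> (cell N k))\<bar> \<le> e / 4"
      if \<rho>: "\<rho> \<in> M1" for \<rho>
    proof -
      interpret prob_space \<rho> using \<rho> by (rule M1_prob_space)
      have cell [simp]: "cell N k \<in> events" for k using M1_sets[OF \<rho>] by simp
      have "f \<in> borel_measurable unif"
        using borel_measurable_continuous_on_restrict[OF f]
        by (simp add: unif_def cong: measurable_cong_sets sets_restrict_space_cong)
      then have f_meas: "f \<in> borel_measurable \<rho>"
        using measurable_cong_sets[OF M1_sets[OF \<rho>] refl] by blast
      have "compact (f ` {0..1})"
        using f by (intro compact_continuous_image) auto
      then obtain B where "\<And>x. x \<in> {0..1} \<Longrightarrow> norm (f x) \<le> B"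
        using compact_imp_bounded bounded_iff by (metis imageI)
      then have int_f: "integrable \<rho> f"
        using f_meas M1_space[OF \<rho>] by (intro integrable_const_bound[where B = B]) auto
      have int_cell: "integrable \<rho> (\<lambda>x. f (real k / real N) * indicator (cell N k) x)" for k
        by (intro integrable_mult_right integrable_real_indicator) (simp_all add: emeasure_eq_measure)
      then have int_g: "integrable \<rho> g"
        unfolding g_def by (intro Bochner_Integration.integrable_sum)
      have "(\<integral>x. g x \<partial>\<rho>) = (\<Sum>k\<le>N. \<integral>x. f (real k / real N) * indicator (cell N k) x \<partial>\<rho>)"
        unfolding g_def using int_cell by (intro Bochner_Integration.integral_sum)
      also have "\<dots> = (\<Sum>k\<le>N. f (real k / real N) * measure \<rho> (cell N k))"
        using sets.sets_into_space[OF cell] by (simp add: Int_absorb2)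
      finally have "(\<integral>x. g x \<partial>\<rho>) = (\<Sum>k\<le>N. f (real k / real N) * measure \<rho> (cell N k))" .
      moreover have "\<bar>\<integral>x. f x - g x \<partial>\<rho>\<bar> \<le> (\<integral>x. \<bar>f x - g x\<bar> \<partial>\<rho>)"
        by (rule integral_abs_bound)
      moreover have "(\<integral>x. \<bar>f x - g x\<bar> \<partial>\<rho>) \<le> (\<integral>x. e / 4 \<partial>\<rho>)"
        using int_f int_g g M1_space[OF \<rho>] by (intro integral_mono) auto
      ultimately show ?thesis
        using int_f int_g by (simp add: prob_space)
    qed
    \<comment> \<open>The index is an integer because the lower endpoint of cell 0 is -1/N.\<close>
    have ray_lim: "(\<lambda>n. measure (\<mu> n) (ray (real_of_int k / real N))) \<longlonglongrightarrow> measure \<sigma> (ray (real_of_int k / real N))" for k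
      using lim[of "of_int k / of_nat N"] by (simp add: of_rat_divide)
    have cell_lim: "(\<lambda>n. measure (\<mu> n) (cell N k)) \<longlonglongrightarrow> measure \<sigma> (cell N k)" for k
    proof -
      have "(\<lambda>n. measure (\<mu> n) (ray (real k / real N)) - measure (\<mu> n) (ray ((real k - 1) / real N)))
          \<longlonglongrightarrow> measure \<sigma> (cell N k)"
        unfolding measure_cell[OF \<sigma> N(1)]
        using tendsto_diff[OF ray_lim[of "int k"] ray_lim[of "int k - 1"]] by simp
      then show ?thesis
        by (rule Lim_transform_eventually) (use \<mu> N(1) in \<open>auto elim!: eventually_mono simp: measure_cell\<close>)
    qed
    have "(\<lambda>n. \<Sum>k\<le>N. f (real k / real N) * measure (\<mu> n) (cell N k))
        \<longlonglongrightarrow> (\<Sum>k\<le>N. f (real k / real N) * measure \<sigma> (cell N k))"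
      by (intro tendsto_intros cell_lim)
    then have "eventually (\<lambda>n. dist (\<Sum>k\<le>N. f (real k / real N) * measure (\<mu> n) (cell N k))
        (\<Sum>k\<le>N. f (real k / real N) * measure \<sigma> (cell N k)) < e / 4) sequentially"
      using \<open>e > 0\<close> by (intro tendstoD) auto
    with \<mu> show "eventually (\<lambda>n. dist (\<integral>x. f x \<partial>\<mu> n) (\<integral>x. f x \<partial>\<sigma>) < e) sequentially"
    proof eventually_elim
      case (elim n)
      then show ?case
        using integral_g[OF \<sigma>] integral_g[OF elim(1)] \<open>e > 0\<close> unfolding dist_real_def by linarith
    qed
  qed
qed


section \<open>Grid entropy and limit points\<close>

lemma measurable_unif_borel: "(\<lambda>x. x) \<in> borel_measurable unif"
  unfolding unif_def by (intro measurable_restrict_space1) simp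

lemma measurable_environment_label:
  assumes "k \<in> {1..D}"
  shows "(\<lambda>u. u i k) \<in> borel_measurable (environment D)"
proof -
  have "(\<lambda>u. u i) \<in> measurable (environment D) (cube D)"
    unfolding environment_def by measurable
  from measurable_compose[OF measurable_compose[OF this measurable_cube_component[OF assms]] measurable_unif_borel]
  show ?thesis .
qed

lemma measurable_observed: "(\<lambda>\<omega>. observed \<omega> i) \<in> borel_measurable (strategy_space D)"
  unfolding observed_def
proof (rule measurable_compose_countable'[where I = "{1..D}"])
  show "(\<lambda>\<omega>. fst \<omega> i k) \<in> borel_measurable (strategy_space D)" if "k \<in> {1..D}" for k
    unfolding strategy_space_def
    by (rule measurable_compose[OF measurable_fst measurable_environment_label[OF that]])
  show "(\<lambda>\<omega>. snd \<omega> i) \<in> measurable (strategy_space D) (count_space {1..D})"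
    unfolding strategy_space_def by measurable
qed simp

lemma measurable_ecdf_observed: "(\<lambda>\<omega>. ecdf (observed \<omega>) n q) \<in> borel_measurable (strategy_space D)"
proof -
  have "Measurable.pred (strategy_space D) (\<lambda>\<omega>. observed \<omega> i \<le> q)" for i
    using measurable_observed[of i D] by measurable
  then show ?thesis
    unfolding ecdf_def by measurable
qed

lemma environment_label_unit: "u \<in> space (environment D) \<Longrightarrow> k \<in> {1..D} \<Longrightarrow> u i k \<in> {0..1}"
  using space_cube_component[of "u i" D k] by (auto simp: environment_def space_PiM)

lemma strategy_space_choice: "\<omega> \<in> space (strategy_space D) \<Longrightarrow> snd \<omega> i \<in> {1..D}"
  by (auto simp: strategy_space_def space_pair_measure space_PiM)

lemma strategy_space_environment: "\<omega> \<in> space (strategy_space D) \<Longrightarrow> fst \<omega> \<in> space (environment D)"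
  by (auto simp: strategy_space_def space_pair_measure)

lemma observed_unit:
  "u \<in> space (environment D) \<Longrightarrow> j i \<in> {1..D} \<Longrightarrow> observed (u, j) i \<in> {0..1}"
  using environment_label_unit[of u D "j i" i] by (simp add: observed_def)

lemma strategy_space_eq: "strategy D S \<Longrightarrow> space S = space (strategy_space D)"
  by (rule sets_eq_imp_space_eq) (simp add: strategy_def)

lemma AE_strategy_environment:
  assumes S: "strategy D S" and P: "AE u in environment D. P u"
  shows "AE \<omega> in S. P (fst \<omega>)"
proof -
  have "fst \<in> measurable S (environment D)"
    using S measurable_cong_sets[of S "strategy_space D" "environment D" "environment D"]
    by (simp add: strategy_def strategy_space_def)
  moreover have eq: "distr S (environment D) fst = environment D"
    using S by (simp add: strategy_def)
  from P have "AE u in distr S (environment D) fst. P u"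
    unfolding eq .
  ultimately show ?thesis
    by (rule AE_distrD)
qed

lemma AE_product_strategy_ecdf:
  assumes \<psi>: "\<And>i. single_edge_strategy D (\<psi> i)"
  shows "AE \<omega> in product_strategy D \<psi>. \<forall>q::rat.
    (\<lambda>n. ecdf (observed \<omega>) n (of_rat q)
      - (\<Sum>i<n. measure (single_edge_law (\<psi> i)) (ray (of_rat q))) / real n) \<longlonglongrightarrow> 0"
proof -
  let ?h = "\<lambda>w. (\<lambda>i. fst (w i), \<lambda>i. snd (w i)) :: (nat \<Rightarrow> nat \<Rightarrow> real) \<times> (nat \<Rightarrow> nat)"
  have sets: "sets (\<psi> i) = sets (cube D \<Otimes>\<^sub>M count_space {1..D})" for i
    using \<psi> by (simp add: single_edge_strategy_def)
  have space: "space (\<psi> i) = space (cube D) \<times> {1..D}" for i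
    using sets_eq_imp_space_eq[OF sets] by (simp add: space_pair_measure)
  have fst: "fst \<in> measurable (\<psi> i) (cube D)" for i
    unfolding measurable_cong_sets[OF sets refl] by measurable
  have snd: "snd \<in> measurable (\<psi> i) (count_space {1..D})" for i
    unfolding measurable_cong_sets[OF sets refl] by measurable
  have fst_i: "(\<lambda>w. fst (w i)) \<in> measurable (PiM UNIV \<psi>) (cube D)" for i
    using measurable_component_singleton[of i UNIV \<psi>] fst by (rule measurable_compose) simp
  have snd_i: "(\<lambda>w. snd (w i)) \<in> measurable (PiM UNIV \<psi>) (count_space {1..D})" for i
    using measurable_component_singleton[of i UNIV \<psi>] snd by (rule measurable_compose) simp
  have "(\<lambda>w i. fst (w i)) \<in> measurable (PiM UNIV \<psi>) (environment D)"
    unfolding environment_def using measurable_space[OF fst_i]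
    by (intro measurable_PiM_single' fst_i) auto
  moreover have "(\<lambda>w i. snd (w i)) \<in> measurable (PiM UNIV \<psi>) (PiM UNIV (\<lambda>_. count_space {1..D}))"
    using measurable_space[OF snd_i] by (intro measurable_PiM_single' snd_i) auto
  ultimately have h: "?h \<in> measurable (PiM UNIV \<psi>) (strategy_space D)"
    unfolding strategy_space_def by (rule measurable_Pair)
  have "AE \<omega> in product_strategy D \<psi>.
    (\<lambda>n. ecdf (observed \<omega>) n q
      - (\<Sum>i<n. measure (single_edge_law (\<psi> i)) (ray q)) / real n) \<longlonglongrightarrow> 0" for q
  proof -
    let ?E = "\<lambda>i. (\<lambda>(u, j). u j) -` ray q \<inter> space (\<psi> i)"
    have E: "?E i \<in> sets (\<psi> i)" for i
      using measurable_single_edge_label'[OF \<psi>] ray_sets by (rule measurable_sets)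
    have law: "measure (single_edge_law (\<psi> i)) (ray q) = measure (\<psi> i) (?E i)" for i
      unfolding single_edge_law_def using measurable_single_edge_label'[OF \<psi>] ray_sets
      by (rule measure_distr)
    have "AE w in PiM UNIV \<psi>.
      (\<lambda>n. ((\<Sum>i<n. indicat_real (?E i) (w i)) - (\<Sum>i<n. measure (\<psi> i) (?E i))) / real n) \<longlonglongrightarrow> 0"
      using \<psi> E by (intro strong_law_PiM) (simp_all add: single_edge_strategy_def)
    with AE_space have "AE w in PiM UNIV \<psi>. (\<lambda>n. ecdf (observed (?h w)) n q
        - (\<Sum>i<n. measure (single_edge_law (\<psi> i)) (ray q)) / real n) \<longlonglongrightarrow> 0"
    proof eventually_elim
      case (elim w)
      have "indicat_real (?E i) (w i) = of_bool (observed (?h w) i \<le> q)" for i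
      proof -
        have w: "w i \<in> space (\<psi> i)" using elim(1) by (auto simp: space_PiM)
        then have "fst (w i) (snd (w i)) \<in> {0..1}"
          using space_cube_component[of "fst (w i)" D "snd (w i)"] by (auto simp: space)
        with w show ?thesis
          by (auto simp: observed_def indicator_def case_prod_beta)
      qed
      then show ?case
        using elim(2) by (simp add: ecdf_def law diff_divide_distrib)
    qed
    \<comment> \<open>The event has to be measurable before an almost sure statement can be pushed
      from the product space to its image.\<close>
    moreover have "{\<omega>\<in>space (strategy_space D). (\<lambda>n. ecdf (observed \<omega>) n q
        - (\<Sum>i<n. measure (single_edge_law (\<psi> i)) (ray q)) / real n) \<longlonglongrightarrow> 0} \<in> sets (strategy_space D)"
    proof -
      have "(\<lambda>\<omega>. ecdf (observed \<omega>) n q - (\<Sum>i<n. measure (single_edge_law (\<psi> i)) (ray q)) / real n)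
          \<in> borel_measurable (strategy_space D)" for n
        using measurable_ecdf_observed by (intro borel_measurable_diff borel_measurable_const)
      from measurable_limit[OF this, where c = 0] show ?thesis
        by (simp add: pred_def)
    qed
    ultimately show ?thesis
      unfolding product_strategy_def using h by (subst AE_distr_iff) auto
  qed
  then show ?thesis
    unfolding AE_all_countable by blast
qed

section \<open>Order statistics over paths\<close>

lemma kth_min_attained:
  assumes "finite S" "1 \<le> k" "k \<le> card S"
  shows "\<exists>x\<in>S. kth_min k S f = ereal (f x)"
proof -
  let ?xs = "sorted_list_of_multiset (image_mset f (mset_set S))"
  have "length ?xs = card S"
    using assms(1) by (metis mset_sorted_list_of_multiset size_mset size_image_mset size_mset_set)
  then have "?xs ! (k - 1) \<in> set ?xs"
    using assms by (intro nth_mem) simp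
  then have "?xs ! (k - 1) \<in> f ` S"
    using assms(1) by simp
  then show ?thesis
    using assms(3) by (auto simp: kth_min_def)
qed

lemma kth_min_1_le:
  assumes "finite S" "x \<in> S"
  shows "kth_min 1 S f \<le> ereal (f x)"
proof -
  let ?xs = "sorted_list_of_multiset (image_mset f (mset_set S))"
  have "f x \<in> set ?xs" using assms by simp
  then obtain i where i: "i < length ?xs" "?xs ! i = f x"
    unfolding in_set_conv_nth by blast
  have "?xs ! 0 \<le> ?xs ! i"
    using i(1) by (intro sorted_nth_mono sorted_sorted_list_of_multiset) auto
  moreover have "1 \<le> card S"
    using assms card_gt_0_iff[of S] by (simp add: Suc_le_eq) blast
  ultimately show ?thesis
    using i(2) by (simp add: kth_min_def)
qed

lemma finite_paths: "finite (paths D n)"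
  unfolding paths_def by (intro finite_PiE) auto

lemma paths_nonempty: "D \<ge> 1 \<Longrightarrow> paths D n \<noteq> {}"
  by (auto simp: paths_def PiE_eq_empty_iff)

lemma paths_choice: "\<pi> \<in> paths D n \<Longrightarrow> i < n \<Longrightarrow> \<pi> i \<in> {1..D}"
  unfolding paths_def by (erule PiE_mem) simp

text \<open>The first n choices of the strategy that repeats p form a path. Keeping only the
  existence of a good path leaves a statement about the environment alone, which passes to the first
  marginal. The tolerance involves \<open>Suc N\<close> so as to be positive at N = 0 as
  well.\<close>

lemma sigma_law_limit_at_path:
  assumes "choice_vector D p"
  shows "AE u in environment D. \<forall>N::nat. eventually (\<lambda>n. \<exists>\<pi>\<in>paths D n. \<forall>k\<le>N.
    \<bar>ecdf (observed (u, \<pi>)) n (real k / real N) - measure (sigma_law D p) (ray (real k / real N))\<bar>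
      < 1 / (real (Suc N))\<^sup>2) sequentially"
    (is "AE u in environment D. \<forall>N. eventually (\<lambda>n. \<exists>\<pi>\<in>paths D n. \<forall>k\<le>N. ?P N n k (u, \<pi>)) sequentially")
proof -
  let ?S = "product_strategy D (\<lambda>_. single_edge_of D p)"
  have \<psi>: "single_edge_strategy D (single_edge_of D p)"
    using assms by (rule single_edge_strategy_of)
  then have S: "strategy D ?S"
    by (intro strategy_independent) (auto simp: independent_strategy_def)
  have "AE \<omega> in ?S. \<forall>N. eventually (\<lambda>n. \<exists>\<pi>\<in>paths D n. \<forall>k\<le>N. ?P N n k (fst \<omega>, \<pi>)) sequentially"
    using AE_product_strategy_ecdf[of D "\<lambda>_. single_edge_of D p", OF \<psi>] AE_space
  proof eventually_elim
    case (elim \<omega>)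
    have \<omega>: "\<omega> \<in> space (strategy_space D)"
      using elim(2) strategy_space_eq[OF S] by simp
    show ?case
    proof
      fix N
      have "eventually (\<lambda>n. \<bar>ecdf (observed \<omega>) n (real k / real N)
          - measure (sigma_law D p) (ray (real k / real N))\<bar> < 1 / (real (Suc N))\<^sup>2) sequentially" for k
      proof -
        let ?q = "of_nat k / of_nat N :: rat"
        have q: "of_rat ?q = real k / real N" by (simp add: of_rat_divide)
        have "eventually (\<lambda>n. dist (ecdf (observed \<omega>) n (of_rat ?q)
            - (\<Sum>i<n. measure (single_edge_law (single_edge_of D p)) (ray (of_rat ?q))) / real n) 0
            < 1 / (real (Suc N))\<^sup>2) sequentially"
          using elim(1) by (intro tendstoD) auto
        with eventually_gt_at_top[of 0] show ?thesis
          by eventually_elim (simp add: q sigma_law_def)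
      qed
      then have "eventually (\<lambda>n. \<forall>k\<in>{..N}. \<bar>ecdf (observed \<omega>) n (real k / real N)
          - measure (sigma_law D p) (ray (real k / real N))\<bar> < 1 / (real (Suc N))\<^sup>2) sequentially"
        by (intro eventually_ball_finite) auto
      then show "eventually (\<lambda>n. \<exists>\<pi>\<in>paths D n. \<forall>k\<le>N. ?P N n k (fst \<omega>, \<pi>)) sequentially"
      proof eventually_elim
        case (elim n)
        have "restrict (snd \<omega>) {..<n} \<in> paths D n"
          unfolding paths_def using strategy_space_choice[OF \<omega>] by auto
        moreover have "ecdf (observed (fst \<omega>, restrict (snd \<omega>) {..<n})) n q = ecdf (observed \<omega>) n q" for q
          unfolding ecdf_def observed_def by simp
        ultimately show ?case
          using elim by (intro bexI[of _ "restrict (snd \<omega>) {..<n}"]) auto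
      qed
    qed
  qed
  \<comment> \<open>There are finitely many paths of length n, so the existential quantifier is a
    finite union of measurable events.\<close>
  moreover have "{u \<in> space (environment D).
      \<forall>N. eventually (\<lambda>n. \<exists>\<pi>\<in>paths D n. \<forall>k\<le>N. ?P N n k (u, \<pi>)) sequentially} \<in> sets (environment D)"
  proof -
    define B where "B N n u \<longleftrightarrow> (\<exists>\<pi>\<in>paths D n. \<forall>k\<in>{..N}. ?P N n k (u, \<pi>))" for N n u
    have [measurable]: "Measurable.pred (environment D) (B N n)" for n N
      unfolding B_def
    proof (intro pred_intros_finite finite_paths finite_atMost)
      fix \<pi> k assume \<pi>: "\<pi> \<in> paths D n"
      have "(\<lambda>u. of_bool (u i (\<pi> i) \<le> c) :: real) \<in> borel_measurable (environment D)" if "i < n" for i c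
        using measurable_environment_label[OF paths_choice[OF \<pi> that], of i] by measurable
      then have [measurable]: "(\<lambda>u. ecdf (observed (u, \<pi>)) n c) \<in> borel_measurable (environment D)" for c
        unfolding ecdf_def observed_def fst_conv snd_conv
        by (intro borel_measurable_divide borel_measurable_const borel_measurable_sum) simp
      show "Measurable.pred (environment D) (\<lambda>u. ?P N n k (u, \<pi>))"
        by measurable
    qed
    have "Measurable.pred (environment D) (\<lambda>u. \<forall>N. \<exists>m. \<forall>n. m \<le> n \<longrightarrow> B N n u)"
      by measurable
    then show ?thesis
      unfolding pred_def eventually_sequentially B_def Ball_def[of "{.._}"] atMost_iff .
  qed
  moreover have "fst \<in> measurable ?S (environment D)"
    using S measurable_cong_sets[of ?S "strategy_space D" "environment D" "environment D"]
    by (simp add: strategy_def strategy_space_def)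
  ultimately have "AE u in distr ?S (environment D) fst.
      \<forall>N. eventually (\<lambda>n. \<exists>\<pi>\<in>paths D n. \<forall>k\<le>N. ?P N n k (u, \<pi>)) sequentially"
    by (subst AE_distr_iff) auto
  moreover have "distr ?S (environment D) fst = environment D"
    using S by (simp add: strategy_def)
  ultimately show ?thesis
    by (simp only:)
qed

lemma empirical_observed_M1:
  assumes "u \<in> space (environment D)" "n > 0" "\<And>i. i < n \<Longrightarrow> j i \<in> {1..D}"
  shows "empirical (observed (u, j)) n \<in> M1"
  using assms observed_unit by (intro empirical_in_M1) auto

lemma measure_empirical_observed:
  assumes "u \<in> space (environment D)" "\<And>i. i < n \<Longrightarrow> j i \<in> {1..D}"
  shows "measure (empirical (observed (u, j)) n) (ray q) = ecdf (observed (u, j)) n q"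
  using assms observed_unit by (intro measure_empirical_ray) auto

lemma sigma_law_finite_entropy:
  assumes D: "D \<ge> 1" and p: "choice_vector D p"
  shows "sigma_law D p \<in> finite_entropy D"
proof -
  let ?\<sigma> = "sigma_law D p"
  have \<sigma>: "?\<sigma> \<in> M1" using p by (rule sigma_law_in_M1)
  \<comment> \<open>The witness is \<alpha> = 0: the rank is then exp 0 = 1, and one good path for
    each n is enough.\<close>
  have "AE u in environment D. (\<lambda>n. kth_min (nat \<lfloor>exp (0 * real n)\<rfloor>) (paths D n)
      (\<lambda>\<pi>. levy_prokhorov (empirical (observed (u, \<pi>)) n) ?\<sigma>)) \<longlonglongrightarrow> 0"
    using sigma_law_limit_at_path[OF p] AE_space
  proof eventually_elim
    case (elim u)
    let ?f = "\<lambda>n. kth_min 1 (paths D n) (\<lambda>\<pi>. levy_prokhorov (empirical (observed (u, \<pi>)) n) ?\<sigma>)"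
    have nonneg: "0 \<le> ?f n" if "n > 0" for n
    proof -
      have "1 \<le> card (paths D n)"
        using paths_nonempty[OF D, of n] finite_paths[of D n] card_gt_0_iff[of "paths D n"]
        by (simp add: Suc_le_eq)
      then obtain \<pi> where \<pi>: "\<pi> \<in> paths D n" "?f n = ereal (levy_prokhorov (empirical (observed (u, \<pi>)) n) ?\<sigma>)"
        using kth_min_attained[OF finite_paths order.refl] by blast
      then show ?thesis
        using levy_prokhorov_nonneg[OF empirical_observed_M1[of u D n \<pi>, OF elim(2) that paths_choice[OF \<pi>(1)]] \<sigma>]
        by simp
    qed
    have small: "eventually (\<lambda>n. ?f n \<le> ereal (4 / real N)) sequentially" if N: "N > 0" for N
      using elim(1)[rule_format, of N] eventually_gt_at_top[of 0]
    proof eventually_elim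
      case (elim n)
      then obtain \<pi> where \<pi>: "\<pi> \<in> paths D n" and close: "\<And>k. k \<le> N \<Longrightarrow>
          \<bar>ecdf (observed (u, \<pi>)) n (real k / real N) - measure ?\<sigma> (ray (real k / real N))\<bar> < 1 / (real (Suc N))\<^sup>2"
        by blast
      have "1 / (real (Suc N))\<^sup>2 \<le> 1 / (real N)\<^sup>2"
        using N by (intro divide_left_mono power_mono) auto
      then have "\<bar>measure (empirical (observed (u, \<pi>)) n) (ray (real k / real N)) - measure ?\<sigma> (ray (real k / real N))\<bar>
          \<le> 1 / (real N)\<^sup>2" if "k \<le> N" for k
        using close[OF that] measure_empirical_observed[of u D n \<pi>, OF \<open>u \<in> space (environment D)\<close> paths_choice[OF \<pi>]]
        by simp
      then have "levy_prokhorov (empirical (observed (u, \<pi>)) n) ?\<sigma> \<le> 4 / real N"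
        using empirical_observed_M1[of u D n \<pi>, OF \<open>u \<in> space (environment D)\<close> \<open>0 < n\<close> paths_choice[OF \<pi>]]
        by (intro levy_prokhorov_le_of_cdf N \<sigma>)
      then show ?case
        using kth_min_1_le[OF finite_paths \<pi>, of "\<lambda>\<pi>. levy_prokhorov (empirical (observed (u, \<pi>)) n) ?\<sigma>"]
        by (meson ereal_less_eq(3) order.trans)
    qed
    have "?f \<longlonglongrightarrow> 0"
    proof (rule order_tendstoI)
      fix a :: ereal assume "a < 0"
      show "eventually (\<lambda>n. a < ?f n) sequentially"
        using eventually_gt_at_top[of 0]
        by eventually_elim (rule less_le_trans[OF \<open>a < 0\<close> nonneg])
    next
      fix a :: ereal assume "0 < a"
      then obtain e where e: "0 < e" "ereal e < a"
        by (metis ereal_dense2 ereal_less(2))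
      obtain M where M: "1 / real (Suc M) < e / 4"
        using e(1) nat_approx_posE[of "e / 4"] by auto
      then have "4 / real (Suc M) < e" by simp
      then have "ereal (4 / real (Suc M)) < a"
        using e(2) by (meson ereal_less(2) less_ereal.simps(1) order.strict_trans)
      with small[of "Suc M"] show "eventually (\<lambda>n. ?f n < a) sequentially"
        by (auto elim!: eventually_mono)
    qed
    then show ?case by simp
  qed
  then have "0 \<le> grid_entropy D ?\<sigma>"
    unfolding grid_entropy_def zero_ereal_def by (intro Sup_upper imageI) auto
  then show ?thesis
    using \<sigma> by (simp add: finite_entropy_def)
qed

text \<open>The upper bound as a deterministic property of one environment, covering weak and
  Levy-Prokhorov limits at once. \<open>interlaced\<close> is demanded along every further
  subsequence r because the one on which the frequencies converge comes from compactness and is not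
  known in advance.\<close>

definition path_limit_property :: "nat \<Rightarrow> (nat \<Rightarrow> nat \<Rightarrow> real) \<Rightarrow> bool" where
  "path_limit_property D u \<longleftrightarrow> u \<in> space (environment D) \<and>
    (\<forall>\<pi> s :: nat \<Rightarrow> nat. \<forall>\<nu>\<in>M1. (\<forall>n. \<forall>i<n. \<pi> n i \<in> {1..D}) \<longrightarrow> strict_mono s \<longrightarrow>
      (\<forall>r. strict_mono r \<longrightarrow> interlaced (\<lambda>n. empirical (observed (u, \<pi> (s (r n)))) (s (r n))) \<nu>) \<longrightarrow>
      (\<exists>p. choice_vector D p \<and> \<nu> = sigma_law D p))"

lemma path_limit_propertyD:
  assumes "path_limit_property D u" "\<nu> \<in> M1"
    and "\<And>n i. i < n \<Longrightarrow> \<pi> n i \<in> {1..D}" "strict_mono (s :: nat \<Rightarrow> nat)"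
    and "\<And>r. strict_mono r \<Longrightarrow> interlaced (\<lambda>n. empirical (observed (u, \<pi> (s (r n)))) (s (r n))) \<nu>"
  shows "\<exists>p. choice_vector D p \<and> \<nu> = sigma_law D p"
  using assms unfolding path_limit_property_def by blast

lemma AE_path_limit_property: "AE u in environment D. path_limit_property D u"
  using AE_path_limits[of D] AE_space
proof eventually_elim
  case (elim u)
  show ?case
    unfolding path_limit_property_def
  proof (intro conjI allI ballI impI elim(2))
    fix \<pi> :: "nat \<Rightarrow> nat \<Rightarrow> nat" and s :: "nat \<Rightarrow> nat" and \<nu>
    assume \<nu>: "\<nu> \<in> M1" and \<pi>: "\<forall>n. \<forall>i<n. \<pi> n i \<in> {1..D}" and s: "strict_mono s"
      and inter: "\<forall>r. strict_mono r \<longrightarrow> interlaced (\<lambda>n. empirical (observed (u, \<pi> (s (r n)))) (s (r n))) \<nu>"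
    obtain p r where p: "choice_vector D p" and r: "strict_mono r"
      and lim: "\<And>q::rat. (\<lambda>n. ecdf (observed (u, \<pi> (s (r n)))) (s (r n)) (of_rat q))
        \<longlonglongrightarrow> measure (sigma_law D p) (ray (of_rat q))"
      using elim(1) \<pi> s by blast
    have "measure (empirical (observed (u, \<pi> n)) n) (ray q) = ecdf (observed (u, \<pi> n)) n q" for n q
      using \<pi> by (intro measure_empirical_observed[OF elim(2)]) blast
    then have "\<nu> = sigma_law D p"
      using lim inter r by (intro interlaced_unique[OF _ \<nu> sigma_law_in_M1[OF p],
        where \<mu> = "\<lambda>n. empirical (observed (u, \<pi> (s (r n)))) (s (r n))"]) auto
    with p show "\<exists>p. choice_vector D p \<and> \<nu> = sigma_law D p" by blast
  qed
qed

lemma limit_points_subset_sigma_laws: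
  assumes u: "path_limit_property D u" and j: "\<And>i. j i \<in> {1..D}"
  shows "limit_points (empirical (observed (u, j))) \<subseteq> {sigma_law D p | p. choice_vector D p}"
proof
  fix \<nu> assume "\<nu> \<in> limit_points (empirical (observed (u, j)))"
  then obtain s where \<nu>: "\<nu> \<in> M1" and s: "strict_mono s"
      and weak: "weakly_converges (empirical (observed (u, j)) \<circ> s) \<nu>"
    by (auto simp: limit_points_def)
  have "interlaced (\<lambda>n. empirical (observed (u, j)) (s (r n))) \<nu>" if r: "strict_mono r" for r
  proof (rule weakly_converges_interlaced[OF _ \<nu>])
    show "weakly_converges (\<lambda>n. empirical (observed (u, j)) (s (r n))) \<nu>"
      using weak LIMSEQ_subseq_LIMSEQ[OF _ r] unfolding weakly_converges_def by (fastforce simp: comp_def)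
    have sr: "strict_mono (\<lambda>n. s (r n))"
      using strict_mono_o[OF s r] by (simp add: comp_def)
    have "eventually (\<lambda>n. s (r n) > 0) sequentially"
      using filterlim_subseq[OF sr] by (rule eventually_compose_filterlim[OF eventually_gt_at_top])
    then show "eventually (\<lambda>n. empirical (observed (u, j)) (s (r n)) \<in> M1) sequentially"
      using u j by (auto elim!: eventually_mono intro!: empirical_observed_M1[of u D] simp: path_limit_property_def)
  qed
  then show "\<nu> \<in> {sigma_law D p | p. choice_vector D p}"
    using path_limit_propertyD[OF u \<nu> _ s, of "\<lambda>_. j"] j by blast
qed

text \<open>\<nu> is not random, so one environment suffices: two almost sure events in a
  probability space have a common point, and there the paths that attain the k-th minimum are
  followed.\<close>

lemma finite_entropy_subset_sigma_laws:
  assumes D: "D \<ge> 1" and \<nu>: "\<nu> \<in> finite_entropy D"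
  shows "\<exists>p. choice_vector D p \<and> \<nu> = sigma_law D p"
proof -
  interpret env: prob_space "environment D" by (rule prob_space_environment)
  have M1: "\<nu> \<in> M1" and "0 \<le> grid_entropy D \<nu>"
    using \<nu> by (auto simp: finite_entropy_def)
  have "ereal ` {\<alpha>. 0 \<le> \<alpha> \<and> (AE u in environment D.
        (\<lambda>n. kth_min (nat \<lfloor>exp (\<alpha> * real n)\<rfloor>) (paths D n)
               (\<lambda>\<pi>. levy_prokhorov (empirical (observed (u, \<pi>)) n) \<nu>)) \<longlonglongrightarrow> 0)} \<noteq> {}" (is "?A \<noteq> {}")
  proof
    assume "?A = {}"
    then have "grid_entropy D \<nu> = Sup {}"
      unfolding grid_entropy_def by (rule arg_cong)
    with \<open>0 \<le> grid_entropy D \<nu>\<close> show False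
      by (simp add: bot_ereal_def)
  qed
  then obtain \<alpha> where \<alpha>: "0 \<le> \<alpha>" and conv: "AE u in environment D.
        (\<lambda>n. kth_min (nat \<lfloor>exp (\<alpha> * real n)\<rfloor>) (paths D n)
               (\<lambda>\<pi>. levy_prokhorov (empirical (observed (u, \<pi>)) n) \<nu>)) \<longlonglongrightarrow> 0"
    by auto
  have "\<exists>u. path_limit_property D u \<and>
      (\<lambda>n. kth_min (nat \<lfloor>exp (\<alpha> * real n)\<rfloor>) (paths D n)
               (\<lambda>\<pi>. levy_prokhorov (empirical (observed (u, \<pi>)) n) \<nu>)) \<longlonglongrightarrow> 0" (is "\<exists>u. ?P u")
  proof (rule ccontr)
    assume "\<not> (\<exists>u. ?P u)"
    moreover have "AE u in environment D. ?P u"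
      using AE_path_limit_property[of D] conv by (rule eventually_conj)
    ultimately show False
      using env.AE_False by (simp only: simp_thms not_ex)
  qed
  then obtain u where u: "path_limit_property D u"
    and lim: "(\<lambda>n. kth_min (nat \<lfloor>exp (\<alpha> * real n)\<rfloor>) (paths D n)
               (\<lambda>\<pi>. levy_prokhorov (empirical (observed (u, \<pi>)) n) \<nu>)) \<longlonglongrightarrow> 0" (is "?K \<longlonglongrightarrow> 0")
    by blast
  define L where "L n \<pi> = levy_prokhorov (empirical (observed (u, \<pi>)) n) \<nu>" for n \<pi>
  \<comment> \<open>While the rank exceeds the number of paths, \<open>kth_min\<close> is infinite
    and any path serves as a filler; the limit 0 excludes this for large n.\<close>
  have "\<exists>\<pi>. \<pi> \<in> paths D n \<and> (?K n < \<infinity> \<longrightarrow> ?K n = ereal (L n \<pi>))" for n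
  proof (cases "?K n < \<infinity>")
    case True
    then have "nat \<lfloor>exp (\<alpha> * real n)\<rfloor> \<le> card (paths D n)"
      by (auto simp: kth_min_def split: if_splits)
    \<comment> \<open>This uses \<alpha> \<ge> 0, and it is what makes position rank - 1 of the
      sorted list the intended one.\<close>
    moreover have "1 \<le> nat \<lfloor>exp (\<alpha> * real n)\<rfloor>"
      using \<alpha> by (simp add: le_nat_iff le_floor_iff)
    ultimately show ?thesis
      using kth_min_attained[OF finite_paths] unfolding L_def by blast
  next
    case False
    then show ?thesis using paths_nonempty[OF D] by blast
  qed
  then obtain \<pi> where \<pi>: "\<And>n. \<pi> n \<in> paths D n" "\<And>n. ?K n < \<infinity> \<Longrightarrow> ?K n = ereal (L n (\<pi> n))"
    by metis
  have "eventually (\<lambda>n. ?K n < \<infinity>) sequentially"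
    using lim by (rule order_tendstoD) simp
  then have "eventually (\<lambda>n. ?K n = ereal (L n (\<pi> n))) sequentially"
    by (rule eventually_mono) (rule \<pi>(2))
  then have "(\<lambda>n. ereal (L n (\<pi> n))) \<longlonglongrightarrow> ereal 0"
    using lim unfolding zero_ereal_def by (rule Lim_transform_eventually[rotated])
  then have L: "(\<lambda>n. L n (\<pi> n)) \<longlonglongrightarrow> 0"
    by simp
  have "interlaced (\<lambda>n. empirical (observed (u, \<pi> (r n))) (r n)) \<nu>" if r: "strict_mono r" for r
  proof (rule levy_prokhorov_interlaced[OF _ M1])
    show "(\<lambda>n. levy_prokhorov (empirical (observed (u, \<pi> (r n))) (r n)) \<nu>) \<longlonglongrightarrow> 0"
      using LIMSEQ_subseq_LIMSEQ[OF L r] by (simp add: comp_def L_def)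
    have "eventually (\<lambda>n. r n > 0) sequentially"
      using filterlim_subseq[OF r] by (rule eventually_compose_filterlim[OF eventually_gt_at_top])
    then show "eventually (\<lambda>n. empirical (observed (u, \<pi> (r n))) (r n) \<in> M1) sequentially"
      using u paths_choice[OF \<pi>(1)]
      by (auto elim!: eventually_mono intro!: empirical_observed_M1[of u D] simp: path_limit_property_def)
  qed
  then show ?thesis
    using path_limit_propertyD[OF u M1, of \<pi> "\<lambda>n. n"] paths_choice[OF \<pi>(1)]
    by (simp add: strict_mono_def)
qed

lemma finite_entropy_eq_sigma_laws:
  "D \<ge> 1 \<Longrightarrow> finite_entropy D = {sigma_law D p | p. choice_vector D p}"
  using finite_entropy_subset_sigma_laws sigma_law_finite_entropy by blast

text \<open>Block b consists of the times from b! to (b + 1)! - 1. The times before it are a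
  fraction 1/(b + 1) of those up to its end, and at each of them x differs from c by at most 1; this
  ratio is the reason for the factorials.\<close>

lemma average_at_block_end:
  fixes x :: "nat \<Rightarrow> real"
  assumes x: "\<And>i. 0 \<le> x i \<and> x i \<le> 1"
    and block: "\<And>i. fact b \<le> i \<Longrightarrow> i < fact (Suc b) \<Longrightarrow> x i = c" and c: "0 \<le> c" "c \<le> 1"
  shows "\<bar>(\<Sum>i<fact (Suc b). x i) / real (fact (Suc b)) - c\<bar> \<le> 1 / real (Suc b)"
proof -
  have le: "fact b \<le> (fact (Suc b) :: nat)"
    by (rule fact_mono) simp
  have pos: "0 < real (fact (Suc b))" by (simp del: fact_Suc)
  have "(\<Sum>i<fact (Suc b). x i) - real (fact (Suc b)) * c = (\<Sum>i<fact (Suc b). x i - c)"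
    by (simp add: sum_subtractf)
  also have "\<dots> = (\<Sum>i<fact b. x i - c)"
    using le block by (intro sum.mono_neutral_right) auto
  finally have "\<bar>(\<Sum>i<fact (Suc b). x i) - real (fact (Suc b)) * c\<bar> \<le> (\<Sum>i<fact b. \<bar>x i - c\<bar>)"
    by (simp only: sum_abs)
  also have "\<dots> \<le> (\<Sum>i<(fact b :: nat). 1)"
  proof (rule sum_mono)
    show "\<bar>x i - c\<bar> \<le> 1" for i
      using x[of i] c by linarith
  qed
  finally have "\<bar>(\<Sum>i<fact (Suc b). x i) - real (fact (Suc b)) * c\<bar> \<le> real (fact b)"
    by simp
  then have "\<bar>(\<Sum>i<fact (Suc b). x i) - real (fact (Suc b)) * c\<bar> / real (fact (Suc b))
      \<le> real (fact b) / real (fact (Suc b))"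
    using pos by (intro divide_right_mono) auto
  moreover have "real (fact (Suc b)) = real (Suc b) * real (fact b)"
    by (simp only: fact_Suc of_nat_mult of_nat_id)
  then have "real (fact b) / real (fact (Suc b)) = 1 / real (Suc b)"
    by (simp del: fact_Suc of_nat_Suc)
  moreover have "\<bar>(\<Sum>i<fact (Suc b). x i) - real (fact (Suc b)) * c\<bar> / real (fact (Suc b))
      = \<bar>(\<Sum>i<fact (Suc b). x i) / real (fact (Suc b)) - c\<bar>"
  proof -
    have "(\<Sum>i<fact (Suc b). x i) / real (fact (Suc b)) - c
        = ((\<Sum>i<fact (Suc b). x i) - real (fact (Suc b)) * c) / real (fact (Suc b))"
      using pos by (simp add: diff_divide_distrib del: fact_Suc)
    then show ?thesis
      using pos by (simp only: abs_divide abs_of_pos)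
  qed
  ultimately show ?thesis by simp
qed

lemma Least_block:
  fixes i :: nat
  assumes "fact b \<le> i" "i < fact (Suc b)"
  shows "(LEAST b. i < fact (Suc b)) = b"
proof (rule Least_equality)
  fix b' assume "i < fact (Suc b')"
  show "b \<le> b'"
  proof (rule ccontr)
    assume "\<not> b \<le> b'"
    then have "fact (Suc b') \<le> (fact b :: nat)"
      by (intro fact_mono) simp
    then show False
      using assms(1) \<open>i < fact (Suc b')\<close> by linarith
  qed
qed (rule assms(2))

lemma universal_independent_strategy:
  assumes D: "D \<ge> 1"
  obtains S where "independent_strategy D S"
    "AE \<omega> in S. \<forall>p. choice_vector D p \<longrightarrow> sigma_law D p \<in> limit_points (empirical (observed \<omega>))"
proof -
  \<comment> \<open>A law is encoded by its distribution function at the rationals, a point of a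
    countable product of real lines. This space is separable and metrizable, so V has a countable
    dense subset T, and points of the closure are limits of sequences. Convergence in it is
    convergence at each rational, which yields weak convergence.\<close>
  define v where "v p = (\<lambda>q::rat. measure (sigma_law D p) (ray (of_rat q)))" for p
  define V where "V = v ` Collect (choice_vector D)"
  have v01: "0 \<le> v p q \<and> v p q \<le> 1" if "choice_vector D p" for p q
    using prob_space.prob_le_1[OF M1_prob_space[OF sigma_law_in_M1[OF that]]] by (simp add: v_def)
  have "choice_vector D (\<lambda>k _. of_bool (k = 1))"
    using D by (auto simp: choice_vector_def of_bool_def sum.delta)
  then have "V \<noteq> {}" by (auto simp: V_def)
  obtain T where T: "countable T" "T \<subseteq> V" "V \<subseteq> closure T"
    by (rule separable)
  have "T \<noteq> {}" using T(3) \<open>V \<noteq> {}\<close> by auto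
  \<comment> \<open>The first component of the inverse pairing function takes every value infinitely
    often, so every element of T recurs; the second component makes a recurrence as late as
    desired.\<close>
  define \<tau> where "\<tau> b = from_nat_into T (fst (prod_decode b))" for b
  have \<tau>_inf: "\<exists>b>m. \<tau> b = t" if t: "t \<in> T" for t m
  proof -
    obtain k where "from_nat_into T k = t"
      using from_nat_into_surj[OF T(1) t] by blast
    then have "\<tau> (prod_encode (k, Suc m)) = t" by (simp add: \<tau>_def)
    moreover have "m < prod_encode (k, Suc m)"
      using le_prod_encode_2[of "Suc m" k] by simp
    ultimately show ?thesis by blast
  qed
  have "\<exists>p. choice_vector D p \<and> \<tau> b = v p" for b
    using from_nat_into[OF \<open>T \<noteq> {}\<close>, of "fst (prod_decode b)"] T(2) unfolding \<tau>_def V_def by blast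
  then obtain P where P: "\<And>b. choice_vector D (P b)" "\<And>b. \<tau> b = v (P b)"
    by metis
  \<comment> \<open>The number of the block containing time i. Block 0 is empty, as 0! = 1!; time 0
    precedes all blocks and gets the number 0.\<close>
  define \<beta> where "\<beta> i = (LEAST b. i < (fact (Suc b) :: nat))" for i :: nat
  define \<psi> where "\<psi> i = single_edge_of D (P (\<beta> i))" for i
  have \<psi>: "single_edge_strategy D (\<psi> i)" for i
    unfolding \<psi>_def by (intro single_edge_strategy_of P)
  define S where "S = product_strategy D \<psi>"
  have ind: "independent_strategy D S"
    unfolding independent_strategy_def S_def using \<psi> by blast
  then have S: "strategy D S" by (rule strategy_independent)
  have "AE \<omega> in S. \<forall>p. choice_vector D p \<longrightarrow> sigma_law D p \<in> limit_points (empirical (observed \<omega>))"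
    using AE_product_strategy_ecdf[of D \<psi>, OF \<psi>, folded S_def] AE_space
  proof eventually_elim
    case (elim \<omega>)
    have \<omega>: "\<omega> \<in> space (strategy_space D)"
      using elim(2) strategy_space_eq[OF S] by simp
    then have env: "fst \<omega> \<in> space (environment D)" and ch: "snd \<omega> i \<in> {1..D}" for i
      using strategy_space_environment strategy_space_choice by auto
    define N where "N b = (fact (Suc b) :: nat)" for b
    have N_mono: "strict_mono N"
      unfolding N_def by (intro strict_monoI fact_less_mono_nat) auto
    \<comment> \<open>At the end of block b the empirical distribution function is close to the
      average of the laws played so far, by the law of large numbers, and this average is close to
      \<tau> b, by the length of the block.\<close>
    have conv: "(\<lambda>b. ecdf (observed \<omega>) (N b) (of_rat q) - \<tau> b q) \<longlonglongrightarrow> 0" for q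
    proof -
      have "(\<lambda>b. ecdf (observed \<omega>) (N b) (of_rat q) - (\<Sum>i<N b. \<tau> (\<beta> i) q) / real (N b)) \<longlonglongrightarrow> 0"
        using LIMSEQ_subseq_LIMSEQ[OF elim(1)[rule_format, of q] N_mono]
        by (simp add: comp_def \<psi>_def P(2) v_def sigma_law_def)
      moreover have "(\<lambda>b. (\<Sum>i<N b. \<tau> (\<beta> i) q) / real (N b) - \<tau> b q) \<longlonglongrightarrow> 0"
      proof (rule Lim_null_comparison)
        show "eventually (\<lambda>b. norm ((\<Sum>i<N b. \<tau> (\<beta> i) q) / real (N b) - \<tau> b q) \<le> 1 / real (Suc b)) sequentially"
        proof (rule always_eventually, rule allI)
          fix b
          show "norm ((\<Sum>i<N b. \<tau> (\<beta> i) q) / real (N b) - \<tau> b q) \<le> 1 / real (Suc b)"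
            unfolding N_def real_norm_def
            using v01[OF P(1)] Least_block[of b, folded \<beta>_def] by (intro average_at_block_end) (auto simp: P(2) simp del: fact_Suc)
        qed
        show "(\<lambda>b. 1 / real (Suc b)) \<longlonglongrightarrow> 0"
          using LIMSEQ_inverse_real_of_nat by (simp add: inverse_eq_divide)
      qed
      ultimately show ?thesis
        using tendsto_add by fastforce
    qed
    show ?case
    proof (intro allI impI)
      fix p assume p: "choice_vector D p"
      have "v p \<in> closure T" using T(3) p by (auto simp: V_def)
      then obtain x where x: "\<And>m. x m \<in> T" "x \<longlonglongrightarrow> v p"
        unfolding closure_sequential by blast
      \<comment> \<open>Since every element of T recurs, the approximants x m can be met at
        increasing block numbers.\<close>
      have "\<exists>f. \<forall>m. \<tau> (f m) = x m \<and> f m < f (Suc m)"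
        using \<tau>_inf[OF x(1)] by (intro dependent_nat_choice) blast+
      then obtain f where f: "\<And>m. \<tau> (f m) = x m" "strict_mono f"
        unfolding strict_mono_Suc_iff by blast
      have Nf: "strict_mono (\<lambda>m. N (f m))"
        using strict_mono_o[OF N_mono f(2)] by (simp add: comp_def)
      have "(\<lambda>m. ecdf (observed \<omega>) (N (f m)) (of_rat q)) \<longlonglongrightarrow> v p q" for q
      proof -
        have "(\<lambda>m. x m q) \<longlonglongrightarrow> v p q"
          using continuous_on_tendsto_compose[OF continuous_on_product_coordinates[of q] x(2)] by simp
        moreover have "(\<lambda>m. ecdf (observed \<omega>) (N (f m)) (of_rat q) - x m q) \<longlonglongrightarrow> 0"
          using LIMSEQ_subseq_LIMSEQ[OF conv[of q] f(2)] by (simp add: comp_def f(1))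
        ultimately show ?thesis
          using tendsto_add[of "\<lambda>m. ecdf (observed \<omega>) (N (f m)) (of_rat q) - x m q" 0] by force
      qed
      then have "weakly_converges (\<lambda>m. empirical (observed \<omega>) (N (f m))) (sigma_law D p)"
        using env ch
        by (intro weakly_converges_of_cdf[OF sigma_law_in_M1[OF p]])
           (auto simp: v_def N_def measure_empirical_observed[of "fst \<omega>" D _ "snd \<omega>", simplified]
             simp del: fact_Suc
             intro!: always_eventually empirical_observed_M1[of "fst \<omega>" D _ "snd \<omega>", simplified])
      then show "sigma_law D p \<in> limit_points (empirical (observed \<omega>))"
        unfolding limit_points_def using sigma_law_in_M1[OF p] Nf by (auto simp: comp_def)
    qed
  qed
  with ind show ?thesis by (rule that)
qed

section \<open>All strategies in one environment\<close>

lemma AE_strategy_limit_points: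
  assumes "strategy D S"
  shows "AE \<omega> in S. limit_points (empirical (observed \<omega>)) \<subseteq> {sigma_law D p | p. choice_vector D p}"
  using AE_strategy_environment[OF assms AE_path_limit_property] AE_space
proof eventually_elim
  case (elim \<omega>)
  have "\<omega> \<in> space (strategy_space D)"
    using elim(2) strategy_space_eq[OF assms] by simp
  then show ?case
    using limit_points_subset_sigma_laws[OF elim(1), of "snd \<omega>"] strategy_space_choice by simp
qed

lemma AE_common_environment:
  assumes J: "common_environment D M U J" and S: "strategy D S" and P: "AE \<omega> in S. P \<omega>"
  shows "AE w in M. P (U w, J S w)"
proof -
  have m: "(\<lambda>w. (U w, J S w)) \<in> measurable M (strategy_space D)"
    and d: "distr M (strategy_space D) (\<lambda>w. (U w, J S w)) = S"
    using J S unfolding common_environment_def by blast+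
  from P have "AE \<omega> in distr M (strategy_space D) (\<lambda>w. (U w, J S w)). P \<omega>"
    unfolding d .
  with m show ?thesis by (rule AE_distrD)
qed

theorem theoremA:
  fixes D :: nat and M :: "'w measure"
  assumes "D \<ge> 1"
  shows
    "(\<forall>U J. common_environment D M U J \<longrightarrow>
        (AE w in M.
           let all_limits =
                 {\<nu>. \<exists>S. strategy D S \<and> \<nu> \<in> limit_points (empirical (observed (U w, J S w)))};
               independent_limits =
                 {\<nu>. \<exists>S. independent_strategy D S \<and> \<nu> \<in> limit_points (empirical (observed (U w, J S w)))}
           in finite_entropy D = all_limits \<and> all_limits = independent_limits \<and>
              independent_limits = {sigma_law D p | p. choice_vector D p})) \<and>
     (\<forall>S. strategy D S \<longrightarrow>
        (AE \<omega> in S. limit_points (empirical (observed \<omega>)) \<subseteq> finite_entropy D)) \<and>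
     finite_entropy D =
       {\<nu>. \<exists>S. strategy D S \<and> (AE \<omega> in S. \<nu> \<in> limit_points (empirical (observed \<omega>)))} \<and>
     finite_entropy D =
       {\<nu>. \<exists>S. independent_strategy D S \<and> (AE \<omega> in S. \<nu> \<in> limit_points (empirical (observed \<omega>)))} \<and>
     finite_entropy D = {sigma_law D p | p. choice_vector D p}"
proof -
  let ?\<Sigma> = "{sigma_law D p | p. choice_vector D p}"
  have R: "finite_entropy D = ?\<Sigma>"
    using assms by (rule finite_entropy_eq_sigma_laws)
  obtain S0 where S0: "independent_strategy D S0"
    and "AE \<omega> in S0. \<forall>p. choice_vector D p \<longrightarrow> sigma_law D p \<in> limit_points (empirical (observed \<omega>))"
    using universal_independent_strategy[OF assms] by blast
  then have univ: "AE \<omega> in S0. ?\<Sigma> \<subseteq> limit_points (empirical (observed \<omega>))"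
    by (auto elim!: eventually_mono)
  have S0': "strategy D S0" using S0 by (rule strategy_independent)
  have common: "AE w in M.
           let all_limits =
                 {\<nu>. \<exists>S. strategy D S \<and> \<nu> \<in> limit_points (empirical (observed (U w, J S w)))};
               independent_limits =
                 {\<nu>. \<exists>S. independent_strategy D S \<and> \<nu> \<in> limit_points (empirical (observed (U w, J S w)))}
           in finite_entropy D = all_limits \<and> all_limits = independent_limits \<and>
              independent_limits = ?\<Sigma>"
    if J: "common_environment D M U J" for U J
    \<comment> \<open>Two exceptional sets are discarded: where S0 misses a point of \<Sigma>, and
      where U violates the path limit property. The law of U is known as the first marginal of S0,
      so neither depends on the strategy S considered below.\<close>
    using AE_common_environment[OF J S0' univ] AE_space
      AE_common_environment[OF J S0' AE_strategy_environment[OF S0' AE_path_limit_property]]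
  proof eventually_elim
    case (elim w)
    \<comment> \<open>This holds at every point of \<open>space M\<close>, by measurability into the
      strategy space, so the uncountably many strategies S contribute no null sets.\<close>
    have choice: "J S w i \<in> {1..D}" if "strategy D S" for S i
    proof -
      have "(\<lambda>w. (U w, J S w)) \<in> measurable M (strategy_space D)"
        using J that unfolding common_environment_def by blast
      from strategy_space_choice[OF measurable_space[OF this elim(2)], of i] show ?thesis
        by simp
    qed
    have le: "limit_points (empirical (observed (U w, J S w))) \<subseteq> ?\<Sigma>" if "strategy D S" for S
      using elim(3) choice[OF that] by (intro limit_points_subset_sigma_laws) simp_all
    have "{\<nu>. \<exists>S. strategy D S \<and> \<nu> \<in> limit_points (empirical (observed (U w, J S w)))} = ?\<Sigma>"
      using le elim(1) S0' by blast
    moreover have "{\<nu>. \<exists>S. independent_strategy D S \<and> \<nu> \<in> limit_points (empirical (observed (U w, J S w)))} = ?\<Sigma>"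
      using le strategy_independent elim(1) S0 by blast
    ultimately show ?case
      by (simp only: Let_def R)
  qed
  have sub: "\<nu> \<in> ?\<Sigma>" if S: "strategy D S" and \<nu>: "AE \<omega> in S. \<nu> \<in> limit_points (empirical (observed \<omega>))" for S \<nu>
  proof (rule ccontr)
    assume "\<nu> \<notin> ?\<Sigma>"
    with eventually_conj[OF AE_strategy_limit_points[OF S] \<nu>] have "AE \<omega> in S. False"
      by (elim eventually_mono) blast
    then show False
      using S by (simp add: strategy_def prob_space.AE_False)
  qed
  have sup: "AE \<omega> in S0. \<nu> \<in> limit_points (empirical (observed \<omega>))" if "\<nu> \<in> ?\<Sigma>" for \<nu>
    using univ by eventually_elim (use that in blast)
  have "?\<Sigma> = {\<nu>. \<exists>S. strategy D S \<and> (AE \<omega> in S. \<nu> \<in> limit_points (empirical (observed \<omega>)))}"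
    using sub sup S0' by blast
  moreover have "?\<Sigma> = {\<nu>. \<exists>S. independent_strategy D S \<and> (AE \<omega> in S. \<nu> \<in> limit_points (empirical (observed \<omega>)))}"
    using sub sup S0 strategy_independent by blast
  ultimately show ?thesis
    using common AE_strategy_limit_points unfolding R by blast
qed

end
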